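(* Let $k$ be an algebraically closed field of characteristic $2$ or $3$, and let $E/k(T)$ be an elliptic curve. Then: (a) if $E$ has non-constant $j$-invariant (i.e. $j(E)\notin k$), there are at least two points of $\mathbb{P}^1_k$ at which $E$ has bad reduction; (b) if $E$ is non-constant, there is at least one point of $\mathbb{P}^1_k$ at which $E$ has bad reduction. The bounds given in (a) and (b) are sharp: over every such $k$ there is an elliptic curve $E/k(T)$ with $j(E)\notin k$ having bad reduction at exactly two points of $\mathbb{P}^1_k$, and there is a non-constant elliptic curve $E/k(T)$ having bad reduction at exactly one point of $\mathbb{P}^1_k$.
   Context: $k(T)$ is the rational function field in one variable, identified with the function field of $\mathbb{P}^1_k$. An elliptic curve $E/k(T)$ is called constant if there exists a Weierstrass equation for $E$ with coefficients in $k$; otherwise it is non-constant. It has constant $j$-invariant if $j(E)\in k$. For a closed point $s\in\mathbb{P}^1_k$ with local ring $\mathcal{O}_{\mathbb{P}^1_k,s}$ (a discrete valuation ring with fraction field $k(T)$), $E$ has good reduction at $s$ if $E$ admits a smooth model over $\operatorname{Spec}\mathcal{O}_{\mathbb{P}^1_k,s}$ (equivalently, a minimal Weierstrass equation of $E$ over $\mathcal{O}_{\mathbb{P}^1_k,s}$ has discriminant of valuation $0$); otherwise $E$ has bad reduction at $s$. *)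

theory Defs
  imports Complex_Main "HOL-Computational_Algebra.Computational_Algebra"
begin

section \<open>Weierstrass equations over a field\<close>

text \<open>
  The tuple of coefficients of
  \<open>y\<^sup>2 + a1 x y + a3 y = x\<^sup>3 + a2 x\<^sup>2 + a4 x + a6\<close>.
\<close>

datatype 'a weierstrass =
  Weierstrass (a1: 'a) (a2: 'a) (a3: 'a) (a4: 'a) (a6: 'a)

definition weierstrass_poly :: "'a::field weierstrass \<Rightarrow> 'a \<Rightarrow> 'a \<Rightarrow> 'a" where
  "weierstrass_poly E x y =
     y^2 + a1 E * x * y + a3 E * y - (x^3 + a2 E * x^2 + a4 E * x + a6 E)"

definition b2 :: "'a::field weierstrass \<Rightarrow> 'a" where
  "b2 E = a1 E ^ 2 + 4 * a2 E"

definition b4 :: "'a::field weierstrass \<Rightarrow> 'a" where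
  "b4 E = 2 * a4 E + a1 E * a3 E"

definition b6 :: "'a::field weierstrass \<Rightarrow> 'a" where
  "b6 E = a3 E ^ 2 + 4 * a6 E"

definition b8 :: "'a::field weierstrass \<Rightarrow> 'a" where
  "b8 E = a1 E ^ 2 * a6 E + 4 * a2 E * a6 E - a1 E * a3 E * a4 E
            + a2 E * a3 E ^ 2 - a4 E ^ 2"

definition c4 :: "'a::field weierstrass \<Rightarrow> 'a" where
  "c4 E = b2 E ^ 2 - 24 * b4 E"

definition disc :: "'a::field weierstrass \<Rightarrow> 'a" where
  "disc E = - (b2 E ^ 2) * b8 E - 8 * b4 E ^ 3 - 27 * b6 E ^ 2 + 9 * b2 E * b4 E * b6 E"

text \<open>
  An elliptic curve over a field is given by a Weierstrass equation with nonzero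
  discriminant; two such equations give the same curve (up to isomorphism over that
  field) iff they are related by \<open>weierstrass_equation_of\<close> below.
\<close>

definition elliptic_curve :: "'a::field weierstrass \<Rightarrow> bool" where
  "elliptic_curve E \<longleftrightarrow> disc E \<noteq> 0"

definition j_invariant :: "'a::field weierstrass \<Rightarrow> 'a" where
  "j_invariant E = c4 E ^ 3 / disc E"

text \<open>
  The equation obtained by the substitution \<open>x = u\<^sup>2 x' + r\<close>,
  \<open>y = u\<^sup>3 y' + u\<^sup>2 s x' + t\<close> and division by \<open>u\<^sup>6\<close>;
  see \<open>weierstrass_poly_change_vars\<close>.
\<close>

definition change_vars :: "'a::field \<Rightarrow> 'a \<Rightarrow> 'a \<Rightarrow> 'a \<Rightarrow> 'a weierstrass \<Rightarrow> 'a weierstrass" where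
  "change_vars u r s t E = Weierstrass
     ((a1 E + 2 * s) / u)
     ((a2 E - s * a1 E + 3 * r - s^2) / u^2)
     ((a3 E + r * a1 E + 2 * t) / u^3)
     ((a4 E - s * a3 E + 2 * r * a2 E - (t + r * s) * a1 E + 3 * r^2 - 2 * s * t) / u^4)
     ((a6 E + r * a4 E + r^2 * a2 E + r^3 - t * a3 E - t^2 - r * t * a1 E) / u^6)"

definition weierstrass_equation_of :: "'a::field weierstrass \<Rightarrow> 'a weierstrass \<Rightarrow> bool" where
  "weierstrass_equation_of E E' \<longleftrightarrow> (\<exists>u r s t. u \<noteq> 0 \<and> E' = change_vars u r s t E)"

lemma weierstrass_poly_change_vars:
  fixes u r s t :: "'a::field"
  assumes "u \<noteq> 0"
  shows "weierstrass_poly E (u^2 * x + r) (u^3 * y + u^2 * s * x + t) =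
         u^6 * weierstrass_poly (change_vars u r s t E) x y"
proof -
  have *: "u^6 * (p / u) = u^5 * p" "u^6 * (p / u^2) = u^4 * p" "u^6 * (p / u^3) = u^3 * p"
    "u^6 * (p / u^4) = u^2 * p" "u^6 * (p / u^6) = p" for p :: 'a
    using assms by (simp_all add: field_simps eval_nat_numeral)
  have scale: "u^6 * weierstrass_poly (Weierstrass A1 A2 A3 A4 A6) x y =
     u^6 * y^2 + (u^6 * A1) * x * y + (u^6 * A3) * y
       - (u^6 * x^3 + (u^6 * A2) * x^2 + (u^6 * A4) * x + u^6 * A6)" for A1 A2 A3 A4 A6
    by (simp add: weierstrass_poly_def algebra_simps)
  show ?thesis
    unfolding change_vars_def scale * unfolding weierstrass_poly_def by algebra
qed

lemma disc_change_vars: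
  fixes u r s t :: "'a::field"
  assumes "u \<noteq> 0"
  shows "u^12 * disc (change_vars u r s t E) = disc E"
proof -
  define A1 A2 A3 A4 A6 where A: "A1 = a1 (change_vars u r s t E)"
    "A2 = a2 (change_vars u r s t E)" "A3 = a3 (change_vars u r s t E)"
    "A4 = a4 (change_vars u r s t E)" "A6 = a6 (change_vars u r s t E)"
  have h: "u * A1 = a1 E + 2 * s"
    "u^2 * A2 = a2 E - s * a1 E + 3 * r - s^2"
    "u^3 * A3 = a3 E + r * a1 E + 2 * t"
    "u^4 * A4 = a4 E - s * a3 E + 2 * r * a2 E - (t + r * s) * a1 E + 3 * r^2 - 2 * s * t"
    "u^6 * A6 = a6 E + r * a4 E + r^2 * a2 E + r^3 - t * a3 E - t^2 - r * t * a1 E"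
    using assms by (simp_all add: A change_vars_def)
  have w: "disc W = d (a1 W) (a2 W) (a3 W) (a4 W) (a6 W)"
    if "d = (\<lambda>p q v w z. - ((p^2+4*q)^2) * (p^2*z+4*q*z-p*v*w+q*v^2-w^2) - 8*(2*w+p*v)^3
       - 27*(v^2+4*z)^2 + 9*(p^2+4*q)*(2*w+p*v)*(v^2+4*z))" for W and d :: "'a \<Rightarrow> 'a \<Rightarrow> 'a \<Rightarrow> 'a \<Rightarrow> 'a \<Rightarrow> 'a"
    unfolding that disc_def b2_def b4_def b6_def b8_def by simp
  define d :: "'a \<Rightarrow> 'a \<Rightarrow> 'a \<Rightarrow> 'a \<Rightarrow> 'a \<Rightarrow> 'a" where
   "d = (\<lambda>p q v w z. - ((p^2+4*q)^2) * (p^2*z+4*q*z-p*v*w+q*v^2-w^2) - 8*(2*w+p*v)^3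
       - 27*(v^2+4*z)^2 + 9*(p^2+4*q)*(2*w+p*v)*(v^2+4*z))"
  have "u^12 * d A1 A2 A3 A4 A6 = d (u * A1) (u^2 * A2) (u^3 * A3) (u^4 * A4) (u^6 * A6)"
    unfolding d_def by algebra
  also have "\<dots> = d (a1 E) (a2 E) (a3 E) (a4 E) (a6 E)"
    unfolding h unfolding d_def by algebra
  finally show ?thesis
    unfolding w[OF d_def] A .
qed

section \<open>Points of the projective line and reduction\<close>

text \<open>
  The function field \<open>k(T)\<close> is \<open>'k poly fract\<close>. For algebraically closed \<open>k\<close> the
  closed points of the projective line are the elements of \<open>k\<close> and the point at infinity.
\<close>

datatype 'k proj_line = Aff 'k | Infty

definition constants :: "'k::field poly fract set" where
  "constants = range (\<lambda>c. Fract [:c:] 1)"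

fun local_ring :: "'k::field proj_line \<Rightarrow> 'k poly fract set" where
  "local_ring (Aff a) = {Fract p q |p q. poly q a \<noteq> 0}"
| "local_ring Infty = {Fract p q |p q. q \<noteq> 0 \<and> degree p \<le> degree q}"

fun poly_val :: "'k::field proj_line \<Rightarrow> 'k poly \<Rightarrow> int" where
  "poly_val (Aff a) p = int (order a p)"
| "poly_val Infty p = - int (degree p)"

text \<open>The normalized valuation at a point, for nonzero rational functions only.\<close>

definition val :: "'k::field proj_line \<Rightarrow> 'k poly fract \<Rightarrow> int" where
  "val s f = (THE v. \<exists>p q. p \<noteq> 0 \<and> q \<noteq> 0 \<and> f = Fract p q \<and> v = poly_val s p - poly_val s q)"

lemma val_Fract:
  assumes "p \<noteq> 0" "q \<noteq> 0"
  shows "val s (Fract p q) = poly_val s p - poly_val s q"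
  unfolding val_def
proof (rule the_equality)
  show "\<exists>p' q'. p' \<noteq> 0 \<and> q' \<noteq> 0 \<and> Fract p q = Fract p' q' \<and>
          poly_val s p - poly_val s q = poly_val s p' - poly_val s q'"
    using assms by blast
next
  fix v
  assume "\<exists>p' q'. p' \<noteq> 0 \<and> q' \<noteq> 0 \<and> Fract p q = Fract p' q' \<and>
            v = poly_val s p' - poly_val s q'"
  then obtain p' q' where nz: "p' \<noteq> 0" "q' \<noteq> 0" and "Fract p q = Fract p' q'"
    and v: "v = poly_val s p' - poly_val s q'"
    by blast
  then have eq: "p * q' = p' * q"
    using assms by (simp add: eq_fract)
  have add: "poly_val s (f * g) = poly_val s f + poly_val s g" if "f \<noteq> 0" "g \<noteq> 0" for f g
    using that by (cases s) (simp_all add: order_mult degree_mult_eq)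
  have "poly_val s p + poly_val s q' = poly_val s p' + poly_val s q"
    using add[of p q'] add[of p' q] assms nz eq by simp
  with v show "v = poly_val s p - poly_val s q" by simp
qed

lemma mem_local_ring_iff:
  assumes "f \<noteq> 0"
  shows "f \<in> local_ring s \<longleftrightarrow> val s f \<ge> 0"
proof -
  obtain p q where f: "f = Fract p q" and q: "q \<noteq> 0"
    by (cases f) auto
  with assms have p: "p \<noteq> 0" by (auto simp: Zero_fract_def eq_fract)
  show ?thesis
  proof
    assume "f \<in> local_ring s"
    then show "val s f \<ge> 0"
    proof (cases s)
      case (Aff a)
      with \<open>f \<in> local_ring s\<close> obtain p' q' where f': "f = Fract p' q'" and q': "poly q' a \<noteq> 0"
        by auto
      then have nz: "p' \<noteq> 0" "q' \<noteq> 0"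
        using assms by (auto simp: Zero_fract_def eq_fract)
      show ?thesis
        using nz q' Aff by (simp add: f' val_Fract order_0I)
    next
      case Infty
      with \<open>f \<in> local_ring s\<close> obtain p' q' where f': "f = Fract p' q'" and
        q': "q' \<noteq> 0" "degree p' \<le> degree q'"
        by auto
      then have nz: "p' \<noteq> 0"
        using assms by (auto simp: Zero_fract_def eq_fract)
      show ?thesis
        using nz q' Infty by (simp add: f' val_Fract)
    qed
  next
    assume v: "val s f \<ge> 0"
    show "f \<in> local_ring s"
    proof (cases s)
      case (Aff a)
      obtain q' where q': "q = [:-a, 1:] ^ order a q * q'" "\<not> [:-a, 1:] dvd q'"
        using order_decomp[OF q] by blast
      have "order a q \<le> order a p"
        using v p q by (simp add: f val_Fract Aff)
      then have "[:-a, 1:] ^ order a q dvd p"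
        by (meson dvd_trans le_imp_power_dvd order_1)
      then obtain p' where p': "p = [:-a, 1:] ^ order a q * p'"
        by (elim dvdE)
      have q'a: "poly q' a \<noteq> 0" using q'(2) by (simp add: poly_eq_0_iff_dvd)
      then have "q' \<noteq> 0" by auto
      have "p * q' = p' * q"
        by (subst p', subst q'(1)) (simp add: ac_simps)
      then have "f = Fract p' q'"
        using q \<open>q' \<noteq> 0\<close> by (simp add: f eq_fract)
      with q'a show ?thesis by (auto simp: Aff)
    next
      case Infty
      then show ?thesis using v p q f by (auto simp: val_Fract)
    qed
  qed
qed

definition integral_at :: "'k::field proj_line \<Rightarrow> 'k poly fract weierstrass \<Rightarrow> bool" where
  "integral_at s E \<longleftrightarrow> set_weierstrass E \<subseteq> local_ring s"

definition minimal_equation_at ::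
  "'k::field proj_line \<Rightarrow> 'k poly fract weierstrass \<Rightarrow> 'k poly fract weierstrass \<Rightarrow> bool" where
  "minimal_equation_at s E E' \<longleftrightarrow>
     weierstrass_equation_of E E' \<and> integral_at s E' \<and>
     (\<forall>E''. weierstrass_equation_of E E'' \<and> integral_at s E'' \<longrightarrow>
        val s (disc E') \<le> val s (disc E''))"

definition good_reduction :: "'k::field poly fract weierstrass \<Rightarrow> 'k proj_line \<Rightarrow> bool" where
  "good_reduction E s \<longleftrightarrow> (\<exists>E'. minimal_equation_at s E E' \<and> val s (disc E') = 0)"

definition bad_reduction :: "'k::field poly fract weierstrass \<Rightarrow> 'k proj_line \<Rightarrow> bool" where
  "bad_reduction E s \<longleftrightarrow> \<not> good_reduction E s"

definition constant_curve :: "'k::field poly fract weierstrass \<Rightarrow> bool" where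
  "constant_curve E \<longleftrightarrow>
     (\<exists>E'. weierstrass_equation_of E E' \<and> set_weierstrass E' \<subseteq> constants)"

end

theory Submission
  imports Defs
begin

text \<open>
  Suppose first that \<open>E\<close> has good reduction at every finite point. Each point where the given
  equation is not a smooth model can be repaired by a change of variables that is harmless
  at the other finite points, because every rational function splits into a part regular at the point and a part
  regular at all other finite points (\<open>partial_fraction\<close>, \<open>glue_local_equation\<close>). So \<open>E\<close> has an
  equation with polynomial coefficients whose discriminant is a nonzero constant
  (\<open>global_affine_equation\<close>).

  If \<open>E\<close> also has good reduction at infinity, a further repair there makes the coefficients
  functions without poles on the projective line, that is, constants; this is the bound for
  non-constant curves.

  If \<open>E\<close> has at most one bad point, a Moebius transformation moves it to infinity, and the
  \<open>j\<close>-invariant must be shown to be constant. In characteristic \<open>2\<close> and \<open>3\<close> it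
  equals \<open>a1\<^sup>1\<^sup>2 / \<Delta>\<close>, respectively \<open>b2\<^sup>6 / \<Delta>\<close>, where the discriminant \<open>\<Delta>\<close> is a constant; the zeros
  of \<open>a1\<close> or \<open>b2\<close> are the points of supersingular reduction. The shape of the discriminant
  shows that this polynomial is a \<open>q\<close>-th power (\<open>q = 4\<close>, respectively \<open>3\<close>) and that its root satisfies a relation of
  the same kind (\<open>frobenius_descent\<close>). Geometrically this is the statement that \<open>E\<close> is a Frobenius
  pullback of another curve with good reduction on the affine line. The degree cannot be divided by
  \<open>q\<close> forever unless it is zero.

  The bounds are attained by \<open>y\<^sup>2 + x y = x\<^sup>3 + T\<close>, with discriminant \<open>- T\<close> in both characteristics,
  and by Artin-Schreier twists of constant curves, which ramify only at infinity:
  \<open>y\<^sup>2 + x y = x\<^sup>3 + T x\<^sup>2 + 1\<close> in characteristic \<open>2\<close> and \<open>y\<^sup>2 = x\<^sup>3 - x + T\<close> in characteristic \<open>3\<close>.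
\<close>

section \<open>Local rings\<close>

lemma Fract_local_ring_Aff: "poly q a \<noteq> 0 \<Longrightarrow> Fract p q \<in> local_ring (Aff a)"
  by auto

lemma Fract_local_ring_Infty: "q \<noteq> 0 \<Longrightarrow> degree p \<le> degree q \<Longrightarrow> Fract p q \<in> local_ring Infty"
  by auto

lemma local_ring_const [simp]: "to_fract [:c:] \<in> local_ring s"
  by (cases s) (auto simp: to_fract_def simp del: local_ring.simps
                     intro!: Fract_local_ring_Aff Fract_local_ring_Infty)

lemma local_ring_0 [simp]: "0 \<in> local_ring s"
  using local_ring_const[of 0 s] by simp

lemma local_ring_1 [simp]: "1 \<in> local_ring s"
  using local_ring_const[of 1 s] by (simp flip: one_pCons)

lemma local_ring_add: "f + g \<in> local_ring s" if "f \<in> local_ring s" "g \<in> local_ring s"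
proof (cases s)
  case (Aff a)
  with that obtain p q p' q' where "f = Fract p q" "poly q a \<noteq> 0" "g = Fract p' q'" "poly q' a \<noteq> 0"
    by auto
  then have "f + g = Fract (p * q' + p' * q) (q * q')" "poly (q * q') a \<noteq> 0"
    by (auto intro!: add_fract)
  then show ?thesis unfolding Aff by fastforce
next
  case Infty
  with that obtain p q p' q' where *: "f = Fract p q" "q \<noteq> 0" "g = Fract p' q'" "q' \<noteq> 0"
    "degree p \<le> degree q" "degree p' \<le> degree q'" by auto
  then have "f + g = Fract (p * q' + p' * q) (q * q')" "q * q' \<noteq> 0" by auto
  moreover have "degree (p * q' + p' * q) \<le> degree (q * q')"
    using * by (intro degree_add_le) (auto simp: degree_mult_eq intro!: order.trans[OF degree_mult_le])
  ultimately show ?thesis unfolding Infty by fastforce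
qed

lemma local_ring_mult: "f * g \<in> local_ring s" if "f \<in> local_ring s" "g \<in> local_ring s"
proof (cases s)
  case (Aff a)
  with that obtain p q p' q' where "f = Fract p q" "poly q a \<noteq> 0" "g = Fract p' q'" "poly q' a \<noteq> 0"
    by auto
  then have "f * g = Fract (p * p') (q * q')" "poly (q * q') a \<noteq> 0" by auto
  then show ?thesis unfolding Aff by fastforce
next
  case Infty
  with that obtain p q p' q' where *: "f = Fract p q" "q \<noteq> 0" "g = Fract p' q'" "q' \<noteq> 0"
    "degree p \<le> degree q" "degree p' \<le> degree q'" by auto
  then have "f * g = Fract (p * p') (q * q')" "q * q' \<noteq> 0" by auto
  moreover have "degree (p * p') \<le> degree (q * q')"
    using * by (auto simp: degree_mult_eq intro!: order.trans[OF degree_mult_le])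
  ultimately show ?thesis unfolding Infty by fastforce
qed

lemma local_ring_uminus: "- f \<in> local_ring s" if "f \<in> local_ring s"
proof -
  have "to_fract [:-1:] * f \<in> local_ring s" by (intro local_ring_mult that local_ring_const)
  also have "to_fract [:-1:] * f = - f"
  proof -
    have "to_fract [:-1:] = - to_fract [:1 :: 'a:]" by (simp flip: to_fract_uminus)
    then show ?thesis by (simp flip: one_pCons)
  qed
  finally show ?thesis .
qed

lemma local_ring_diff: "f - g \<in> local_ring s" if "f \<in> local_ring s" "g \<in> local_ring s"
  using local_ring_add[OF that(1) local_ring_uminus[OF that(2)]] by simp

lemma local_ring_power: "f ^ n \<in> local_ring s" if "f \<in> local_ring s"
  using that by (induction n) (auto intro: local_ring_mult)

lemma local_ring_numeral [simp]: "numeral n \<in> local_ring s"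
  by (induction n) (simp_all only: numeral.simps local_ring_1 local_ring_add)

lemmas local_ring_intros =
  local_ring_add local_ring_mult local_ring_diff local_ring_uminus local_ring_power

lemma poly_local_ring [simp]: "to_fract p \<in> local_ring (Aff a)"
  unfolding to_fract_def by (intro Fract_local_ring_Aff) auto

lemma inverse_poly_local_ring: "inverse (to_fract q) \<in> local_ring (Aff a)" if "poly q a \<noteq> 0"
  using that unfolding to_fract_def inverse_fract by (rule Fract_local_ring_Aff)

lemma finite_poles: "finite {a. f \<notin> local_ring (Aff a)}"
proof -
  obtain p q where "f = Fract p q" "q \<noteq> 0" by (cases f) auto
  then have "{a. f \<notin> local_ring (Aff a)} \<subseteq> {a. poly q a = 0}" by auto
  then show ?thesis using poly_roots_finite[OF \<open>q \<noteq> 0\<close>] finite_subset by blast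
qed

text \<open>
  Over an algebraically closed field a nonconstant denominator has a root \<open>a\<close>. A second
  representation of \<open>f\<close> with denominator nonzero at \<open>a\<close> forces \<open>a\<close> to be a root of the
  numerator as well, so a linear factor cancels.
\<close>

lemma pole_free_imp_polynomial:
  fixes f :: "'k::alg_closed_field poly fract"
  assumes "\<And>a. f \<in> local_ring (Aff a)"
  obtains p where "f = to_fract p"
proof -
  have "\<exists>p. f = to_fract p" if "f = Fract p q" "q \<noteq> 0" for p q
    using that
  proof (induction "degree q" arbitrary: p q rule: less_induct)
    case less
    show ?case
    proof (cases "degree q = 0")
      case True
      then obtain c where "q = [:c:]" by (rule degree_eq_zeroE)
      moreover from this less have "c \<noteq> 0" by auto
      ultimately have "f = to_fract (smult (inverse c) p)"
        using less by (auto simp: to_fract_def eq_fract)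
      then show ?thesis by blast
    next
      case False
      then obtain a where a: "poly q a = 0" using alg_closed_imp_poly_has_root[of q] by blast
      obtain p' q' where f: "f = Fract p' q'" "poly q' a \<noteq> 0" using assms[of a] by auto
      then have "q' \<noteq> 0" by auto
      then have "p * q' = p' * q" using f less by (auto simp: eq_fract)
      then have "poly p a = 0" using a f(2) by (metis mult_eq_0_iff poly_mult)
      with a obtain p1 q1 where *: "p = [:-a, 1:] * p1" "q = [:-a, 1:] * q1"
        unfolding poly_eq_0_iff_dvd by (auto elim!: dvdE)
      with less have "q1 \<noteq> 0" by auto
      then have "degree q1 < degree q" using * by (simp add: degree_mult_eq del: mult_pCons_left)
      moreover have "f = Fract p1 q1"
        using \<open>q1 \<noteq> 0\<close> less.prems unfolding * by (simp only: eq_fract simp_thms mult_ac)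
      ultimately show ?thesis using less.hyps \<open>q1 \<noteq> 0\<close> by blast
    qed
  qed
  moreover obtain p q where "f = Fract p q" "q \<noteq> 0" by (cases f) auto
  ultimately show ?thesis using that by blast
qed

lemma local_ring_Infty_polynomial:
  assumes "to_fract p \<in> local_ring Infty"
  obtains c where "p = [:c:]"
proof -
  from assms obtain p' q where *: "to_fract p = Fract p' q" "q \<noteq> 0" "degree p' \<le> degree q" by auto
  then have p': "p' = p * q" by (simp add: to_fract_def eq_fract)
  have "degree p = 0"
  proof (cases "p = 0")
    case False
    then show ?thesis using * p' by (simp add: degree_mult_eq)
  qed auto
  then show ?thesis using that by (auto elim: degree_eq_zeroE)
qed

lemma mem_constants_iff:
  fixes f :: "'k::alg_closed_field poly fract"
  shows "f \<in> constants \<longleftrightarrow> (\<forall>s. f \<in> local_ring s)"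
proof
  assume "f \<in> constants"
  then show "\<forall>s. f \<in> local_ring s" unfolding constants_def by (auto simp flip: to_fract_def)
next
  assume *: "\<forall>s. f \<in> local_ring s"
  then obtain p where "f = to_fract p" using pole_free_imp_polynomial by blast
  moreover from this * obtain c where "p = [:c:]" using local_ring_Infty_polynomial by blast
  ultimately show "f \<in> constants" unfolding constants_def by (auto simp: to_fract_def)
qed

text \<open>
  This is how a discriminant that is a unit at every finite point is seen to be a constant.
\<close>

lemma unit_polynomial_constant:
  fixes f :: "'k::alg_closed_field poly fract"
  assumes "\<And>a. f \<in> local_ring (Aff a)" "\<And>a. inverse f \<in> local_ring (Aff a)" "f \<noteq> 0"
  obtains c where "f = to_fract [:c:]" "c \<noteq> 0"
proof -
  obtain p where p: "f = to_fract p" using assms pole_free_imp_polynomial by blast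
  obtain q where q: "inverse f = to_fract q" using assms pole_free_imp_polynomial by blast
  have "f * inverse f = 1" using assms(3) by simp
  then have "to_fract (p * q) = to_fract 1" unfolding p q[unfolded p] by simp
  then have "p * q = 1" using to_fract_eq_iff by blast
  then have "p dvd 1" by (metis dvd_triv_left)
  then obtain c where "p = [:c:]" "c dvd 1" by (auto simp: is_unit_poly_iff)
  then have "p = [:c:]" "c \<noteq> 0" by auto
  then show ?thesis using p that by blast
qed

lemma val_mult: "val s (f * g) = val s f + val s g" if "f \<noteq> 0" "g \<noteq> 0"
proof -
  obtain p q where f: "f = Fract p q" "q \<noteq> 0" by (cases f) auto
  obtain p' q' where g: "g = Fract p' q'" "q' \<noteq> 0" by (cases g) auto
  have "p \<noteq> 0" "p' \<noteq> 0" using that f g by (auto simp: fract_collapse)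
  then show ?thesis using f g by (cases s) (simp_all add: val_Fract order_mult degree_mult_eq)
qed

lemma val_1 [simp]: "val s 1 = 0"
  by (cases s) (simp_all add: One_fract_def val_Fract)

lemma val_inverse: "val s (inverse f) = - val s f" if "f \<noteq> 0"
  using val_mult[of f "inverse f" s] that by simp

lemma val_power: "val s (f ^ n) = int n * val s f" if "f \<noteq> 0"
  using that by (induction n) (auto simp: val_mult algebra_simps)

text \<open>
  The valuation of \<open>f\<close> is nonnegative at every point because \<open>n\<close> times it is.
\<close>

lemma constant_root:
  fixes f :: "'k::alg_closed_field poly fract"
  assumes "f ^ n \<in> constants" "n > 0" "f \<noteq> 0"
  shows "f \<in> constants"
  unfolding mem_constants_iff
proof
  fix s
  have "val s (f ^ n) \<ge> 0" using assms by (auto simp: mem_constants_iff simp flip: mem_local_ring_iff)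
  then show "f \<in> local_ring s"
    using assms by (simp add: val_power mem_local_ring_iff zero_le_mult_iff)
qed

declare local_ring.simps [simp del]

section \<open>Partial fractions\<close>

text \<open>
  One step of the Taylor expansion at \<open>a\<close>: subtract the value at \<open>a\<close> and divide by the
  uniformizer.
\<close>

lemma local_ring_expand:
  assumes "f \<in> local_ring (Aff a)"
  obtains c g where "f = to_fract [:c:] + to_fract [:-a, 1:] * g" "g \<in> local_ring (Aff a)"
proof -
  from assms obtain p q where f: "f = Fract p q" and q: "poly q a \<noteq> 0"
    by (auto simp: local_ring.simps)
  define c where "c = poly p a / poly q a"
  have "poly (p - smult c q) a = 0" using q by (simp add: c_def)
  then obtain h where h: "p - smult c q = [:-a, 1:] * h" unfolding poly_eq_0_iff_dvd by (auto elim: dvdE)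
  have "q \<noteq> 0" using q by auto
  have "p = smult c q + [:-a, 1:] * h" using h by (simp add: algebra_simps del: mult_pCons_left)
  then have "f = to_fract [:c:] + to_fract [:-a, 1:] * Fract h q"
    using \<open>q \<noteq> 0\<close> unfolding f by (simp add: to_fract_def eq_fract del: mult_pCons_left) simp
  moreover have "Fract h q \<in> local_ring (Aff a)" using q by (rule Fract_local_ring_Aff)
  ultimately show ?thesis using that by blast
qed

text \<open>
  Only finite points are tested. Thus \<open>regular_away (Aff a)\<close> is \<open>k[T, 1/(T - a)]\<close>, poles at
  infinity being harmless, while \<open>regular_away Infty\<close> is the polynomial ring.
\<close>

definition regular_away :: "'k::field proj_line \<Rightarrow> 'k poly fract set" where
  "regular_away s = {f. \<forall>b. Aff b \<noteq> s \<longrightarrow> f \<in> local_ring (Aff b)}"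

lemma regular_away_mult: "f \<in> regular_away s \<Longrightarrow> g \<in> regular_away s \<Longrightarrow> f * g \<in> regular_away s"
  by (auto simp: regular_away_def intro: local_ring_mult)

lemma regular_away_add: "f \<in> regular_away s \<Longrightarrow> g \<in> regular_away s \<Longrightarrow> f + g \<in> regular_away s"
  by (auto simp: regular_away_def intro: local_ring_add)

lemma regular_away_power: "f \<in> regular_away s \<Longrightarrow> f ^ n \<in> regular_away s"
  by (auto simp: regular_away_def intro: local_ring_power)

lemma regular_away_inverse_linear: "inverse (to_fract [:-a, 1:]) \<in> regular_away (Aff a)"
  by (auto simp: regular_away_def intro!: inverse_poly_local_ring)

text \<open>
  \<open>k(T)\<close> is the sum of the local ring at \<open>s\<close> and the functions regular away from \<open>s\<close>. At a
  finite point one splits off the principal part, one Taylor coefficient at a time; at infinity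
  one divides with remainder. This replaces every approximation argument in the gluing of local
  Weierstrass equations.
\<close>

lemma partial_fraction:
  obtains g where "g \<in> local_ring s" "f + g \<in> regular_away s"
proof (cases s)
  case (Aff a)
  let ?\<pi> = "to_fract [:-a, 1:]"
  have \<pi>: "?\<pi> \<noteq> 0" by simp
  have split: "\<exists>g. g \<in> local_ring s \<and> f + g \<in> regular_away s" if "f * ?\<pi> ^ n \<in> local_ring s" for f n
    using that
  proof (induction n arbitrary: f)
    case 0
    then show ?case by (intro exI[of _ "- f"]) (auto simp: regular_away_def local_ring_uminus)
  next
    case (Suc n)
    obtain c h where h: "f * ?\<pi> ^ Suc n = to_fract [:c:] + ?\<pi> * h" "h \<in> local_ring s"
      using local_ring_expand[OF Suc.prems[unfolded Aff]] unfolding Aff by blast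
    define f' where "f' = h * inverse ?\<pi> ^ n"
    have "f' * ?\<pi> ^ n = h" unfolding f'_def using \<pi> by (simp add: field_simps)
    then obtain g where g: "g \<in> local_ring s" "f' + g \<in> regular_away s" using Suc.IH h(2) by metis
    have "f = (f * ?\<pi> ^ Suc n) * inverse ?\<pi> ^ Suc n" using \<pi> by (simp add: field_simps)
    also have "\<dots> = to_fract [:c:] * inverse ?\<pi> ^ Suc n + f'"
      unfolding h f'_def using \<pi> by (simp add: field_simps)
    finally have "f + g = to_fract [:c:] * inverse ?\<pi> ^ Suc n + (f' + g)" by simp
    moreover have "to_fract [:c:] * inverse ?\<pi> ^ Suc n \<in> regular_away s"
      unfolding Aff by (intro regular_away_mult regular_away_power regular_away_inverse_linear)
        (auto simp: regular_away_def)
    ultimately have "f + g \<in> regular_away s" using g(2) regular_away_add by metis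
    with g(1) show ?case by blast
  qed
  obtain p q where f: "f = Fract p q" and "q \<noteq> 0" by (cases f) auto
  obtain q' where q': "q = [:-a, 1:] ^ order a q * q'" "\<not> [:-a, 1:] dvd q'"
    using order_decomp[OF \<open>q \<noteq> 0\<close>] by blast
  have "q' \<noteq> 0" using q' by auto
  have "f * ?\<pi> ^ order a q = Fract p q'"
  proof -
    have "to_fract q = ?\<pi> ^ order a q * to_fract q'"
    proof -
      have "to_fract (x ^ n) = to_fract x ^ n" for x :: "'a poly" and n by (induction n) auto
      then show ?thesis by (subst q'(1)) simp
    qed
    then show ?thesis using \<open>q' \<noteq> 0\<close> \<pi> by (simp add: f Fract_conv_to_fract)
  qed
  moreover have "Fract p q' \<in> local_ring s" using q'(2) unfolding Aff
    by (intro Fract_local_ring_Aff) (simp add: poly_eq_0_iff_dvd)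
  ultimately show ?thesis using split that by metis
next
  case Infty
  obtain p q where f: "f = Fract p q" and "q \<noteq> 0" by (cases f) auto
  have "degree (p mod q) \<le> degree q"
    using \<open>q \<noteq> 0\<close> by (metis degree_0 degree_mod_less less_imp_le_nat zero_le)
  then have "Fract (- (p mod q)) q \<in> local_ring s" unfolding Infty
    using \<open>q \<noteq> 0\<close> by (intro Fract_local_ring_Infty) auto
  moreover have "f + Fract (- (p mod q)) q = to_fract (p div q)"
  proof -
    have "p + - (p mod q) = p div q * q" by (simp add: minus_mod_eq_div_mult)
    then have "(p + - (p mod q)) * q = p div q * (q * q)" by simp
    then show ?thesis using \<open>q \<noteq> 0\<close> by (simp add: f to_fract_def eq_fract algebra_simps)
  qed
  ultimately show ?thesis using that by (auto simp: regular_away_def)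
qed

section \<open>Changes of variables\<close>

text \<open>
  The coefficients of a transformed equation without denominators, so that identities between
  them are polynomial identities.
\<close>

lemma scaled_coefficients:
  fixes u r s t :: "'a::field" and E :: "'a weierstrass"
  assumes "u \<noteq> 0"
  defines "W \<equiv> change_vars u r s t E"
  shows "u * a1 W = a1 E + 2 * s"
    "u^2 * a2 W = a2 E - s * a1 E + 3 * r - s^2"
    "u^3 * a3 W = a3 E + r * a1 E + 2 * t"
    "u^4 * a4 W = a4 E - s * a3 E + 2 * r * a2 E - (t + r * s) * a1 E + 3 * r^2 - 2 * s * t"
    "u^6 * a6 W = a6 E + r * a4 E + r^2 * a2 E + r^3 - t * a3 E - t^2 - r * t * a1 E"
  using assms by (simp_all add: change_vars_def)

lemma change_vars_eqI:
  assumes "u \<noteq> 0"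
    "u * a1 W = a1 E + 2 * s"
    "u^2 * a2 W = a2 E - s * a1 E + 3 * r - s^2"
    "u^3 * a3 W = a3 E + r * a1 E + 2 * t"
    "u^4 * a4 W = a4 E - s * a3 E + 2 * r * a2 E - (t + r * s) * a1 E + 3 * r^2 - 2 * s * t"
    "u^6 * a6 W = a6 E + r * a4 E + r^2 * a2 E + r^3 - t * a3 E - t^2 - r * t * a1 E"
  shows "W = change_vars u r s t E"
proof -
  have *: "x = y / z" if "z \<noteq> 0" "z * x = y" for x y z :: 'a
    using that by (auto simp: field_simps)
  show ?thesis
    using assms by (cases W) (simp add: change_vars_def *)
qed

lemma change_vars_compose:
  fixes u v :: "'a::field"
  assumes "u \<noteq> 0" "v \<noteq> 0"
  shows "change_vars v r' s' t' (change_vars u r s t E) =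
         change_vars (u * v) (r + u^2 * r') (s + u * s') (t + u^2 * s * r' + u^3 * t') E"
proof -
  define W V where "W = change_vars u r s t E" and "V = change_vars v r' s' t' W"
  have uv: "u * v \<noteq> 0" using assms by simp
  have split: "(u * v) * a1 V = u * (v * a1 V)" "(u * v)^2 * a2 V = u^2 * (v^2 * a2 V)"
    "(u * v)^3 * a3 V = u^3 * (v^3 * a3 V)" "(u * v)^4 * a4 V = u^4 * (v^4 * a4 V)"
    "(u * v)^6 * a6 V = u^6 * (v^6 * a6 V)"
    by (simp_all add: power_mult_distrib)
  note W = scaled_coefficients[OF assms(1), of r s t E, folded W_def]
  note V = scaled_coefficients[OF assms(2), of r' s' t' W, folded V_def]
  \<comment> \<open>Scaling by \<open>u\<close> turns the second substitution into one with parameters \<open>u\<^sup>2 r'\<close>, \<open>u s'\<close>,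
    \<open>u\<^sup>3 t'\<close> on the scaled coefficients of \<open>W\<close>, which are known in terms of \<open>E\<close>.\<close>
  have s1: "u * (a1 W + 2 * s') = u * a1 W + 2 * u * s'"
    by algebra
  have s2: "u^2 * (a2 W - s' * a1 W + 3 * r' - s'^2) = u^2 * a2 W - u * s' * (u * a1 W) + 3 * (u^2 * r') - (u * s')^2"
    by algebra
  have s3: "u^3 * (a3 W + r' * a1 W + 2 * t') = u^3 * a3 W + u^2 * r' * (u * a1 W) + 2 * u^3 * t'"
    by algebra
  have s4: "u^4 * (a4 W - s' * a3 W + 2 * r' * a2 W - (t' + r' * s') * a1 W + 3 * r'^2 - 2 * s' * t') =
     u^4 * a4 W - u * s' * (u^3 * a3 W) + 2 * (u^2 * r') * (u^2 * a2 W)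
       - (u^3 * t' + (u^2 * r') * (u * s')) * (u * a1 W) + 3 * (u^2 * r')^2 - 2 * (u * s') * (u^3 * t')"
    by algebra
  have s6: "u^6 * (a6 W + r' * a4 W + r'^2 * a2 W + r'^3 - t' * a3 W - t'^2 - r' * t' * a1 W) =
     u^6 * a6 W + (u^2 * r') * (u^4 * a4 W) + (u^2 * r')^2 * (u^2 * a2 W) + (u^2 * r')^3
       - (u^3 * t') * (u^3 * a3 W) - (u^3 * t')^2 - (u^2 * r') * (u^3 * t') * (u * a1 W)"
    by algebra
  have "V = change_vars (u * v) (r + u^2 * r') (s + u * s') (t + u^2 * s * r' + u^3 * t') E"
  proof (rule change_vars_eqI[OF uv], goal_cases)
    case 1 show ?case unfolding split V s1 W by algebra
  next
    case 2 show ?case unfolding split V s2 W by algebra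
  next
    case 3 show ?case unfolding split V s3 W by algebra
  next
    case 4 show ?case unfolding split V s4 W by algebra
  next
    case 5 show ?case unfolding split V s6 W by algebra
  qed
  then show ?thesis unfolding V_def W_def .
qed

lemma change_vars_id [simp]: "change_vars 1 0 0 0 E = E"
  by (cases E) (simp add: change_vars_def)

lemma weierstrass_equation_of_refl [simp]: "weierstrass_equation_of E E"
  unfolding weierstrass_equation_of_def by (metis change_vars_id zero_neq_one)

lemma weierstrass_equation_of_trans:
  "weierstrass_equation_of E E' \<Longrightarrow> weierstrass_equation_of E' E'' \<Longrightarrow> weierstrass_equation_of E E''"
  unfolding weierstrass_equation_of_def using change_vars_compose by (metis mult_eq_0_iff)

lemma weierstrass_equation_of_sym:
  assumes "weierstrass_equation_of E E'"
  shows "weierstrass_equation_of E' E"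
proof -
  obtain u r s t where u: "u \<noteq> 0" "E' = change_vars u r s t E"
    using assms unfolding weierstrass_equation_of_def by blast
  have "change_vars (1 / u) (- r / u^2) (- s / u) ((r * s - t) / u^3) E' = change_vars 1 0 0 0 E"
    unfolding u(2) using u(1)
    by (subst change_vars_compose) (simp_all add: field_simps)
  then show ?thesis
    unfolding weierstrass_equation_of_def using u(1)
    by (metis change_vars_id divide_eq_0_iff one_neq_zero)
qed

lemma c4_change_vars:
  fixes u r s t :: "'a::field"
  assumes "u \<noteq> 0"
  shows "u^4 * c4 (change_vars u r s t E) = c4 E"
proof -
  define W where "W = change_vars u r s t E"
  note W = scaled_coefficients[OF assms, of r s t E, folded W_def]
  have "u^4 * c4 W = ((u * a1 W)^2 + 4 * (u^2 * a2 W))^2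
                     - 24 * (2 * (u^4 * a4 W) + (u * a1 W) * (u^3 * a3 W))"
    unfolding c4_def b2_def b4_def by algebra
  also have "\<dots> = c4 E"
    unfolding W unfolding c4_def b2_def b4_def by algebra
  finally show ?thesis by (simp add: W_def)
qed

lemma j_invariant_change_vars:
  fixes u r s t :: "'a::field"
  assumes "u \<noteq> 0"
  shows "j_invariant (change_vars u r s t E) = j_invariant E"
proof -
  have "j_invariant E = (u^4 * c4 (change_vars u r s t E))^3 / (u^12 * disc (change_vars u r s t E))"
    by (simp add: j_invariant_def c4_change_vars[OF assms] disc_change_vars[OF assms])
  also have "(u^4 * c4 (change_vars u r s t E))^3 = u^12 * c4 (change_vars u r s t E) ^ 3"
    by (simp add: power_mult_distrib flip: power_mult)
  finally show ?thesis using assms by (simp add: j_invariant_def)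
qed

lemma j_invariant_weierstrass_equation_of:
  "weierstrass_equation_of E E' \<Longrightarrow> j_invariant E' = j_invariant E"
  unfolding weierstrass_equation_of_def using j_invariant_change_vars by blast

lemma disc_nonzero_weierstrass_equation_of:
  "weierstrass_equation_of E E' \<Longrightarrow> disc E \<noteq> 0 \<Longrightarrow> disc E' \<noteq> 0"
  unfolding weierstrass_equation_of_def using disc_change_vars by (metis mult_zero_right)

section \<open>Good reduction\<close>

lemma integral_at_iff:
  "integral_at s E \<longleftrightarrow> a1 E \<in> local_ring s \<and> a2 E \<in> local_ring s \<and> a3 E \<in> local_ring s \<and>
     a4 E \<in> local_ring s \<and> a6 E \<in> local_ring s"
  unfolding integral_at_def by (cases E) auto

lemma integral_b:
  assumes "integral_at s E"
  shows "b2 E \<in> local_ring s" "b4 E \<in> local_ring s" "b6 E \<in> local_ring s" "b8 E \<in> local_ring s"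
  using assms unfolding b2_def b4_def b6_def b8_def integral_at_iff
  by (auto intro!: local_ring_intros)

lemma integral_disc: "integral_at s E \<Longrightarrow> disc E \<in> local_ring s"
  unfolding disc_def by (intro local_ring_intros local_ring_numeral integral_b)

lemma integral_change_vars:
  assumes "integral_at s E" "inverse u \<in> local_ring s" "r \<in> local_ring s" "q \<in> local_ring s"
    "t \<in> local_ring s"
  shows "integral_at s (change_vars u r q t E)"
  using assms unfolding integral_at_iff change_vars_def
  by (simp add: divide_inverse flip: power_inverse) (auto intro!: local_ring_intros)

text \<open>
  Integral with unit discriminant, that is, the equation itself is a smooth Weierstrass model
  over the local ring.
\<close>

definition unimodular_at :: "'k::field proj_line \<Rightarrow> 'k poly fract weierstrass \<Rightarrow> bool" where
  "unimodular_at s E \<longleftrightarrow> integral_at s E \<and> disc E \<noteq> 0 \<and> inverse (disc E) \<in> local_ring s"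

lemma unimodular_change_vars:
  assumes "unimodular_at s E" "u \<noteq> 0" "u \<in> local_ring s" "inverse u \<in> local_ring s"
    "r \<in> local_ring s" "q \<in> local_ring s" "t \<in> local_ring s"
  shows "unimodular_at s (change_vars u r q t E)"
proof -
  let ?E = "change_vars u r q t E"
  have d: "u^12 * disc ?E = disc E" by (rule disc_change_vars) fact
  have E: "integral_at s E" "disc E \<noteq> 0" "inverse (disc E) \<in> local_ring s"
    using assms(1) by (auto simp: unimodular_at_def)
  have "disc ?E \<noteq> 0" using d E(2) by (metis mult_zero_right)
  moreover have "inverse (disc ?E) = u^12 * inverse (disc E)"
    unfolding d[symmetric] using \<open>u \<noteq> 0\<close> by (simp add: inverse_mult_distrib)
  moreover have "u^12 * inverse (disc E) \<in> local_ring s"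
    using assms(3) E(3) by (intro local_ring_intros)
  moreover have "integral_at s ?E" using E assms by (intro integral_change_vars)
  ultimately show ?thesis by (simp add: unimodular_at_def)
qed

text \<open>
  Minimality comes for free: every integral equation has discriminant of nonnegative valuation.
  Consequently good reduction can be expressed by membership in the local ring alone, which makes
  it easy to transport along field homomorphisms.
\<close>

lemma good_reduction_iff:
  assumes "disc E \<noteq> 0"
  shows "good_reduction E s \<longleftrightarrow> (\<exists>E'. weierstrass_equation_of E E' \<and> unimodular_at s E')"
proof
  assume "good_reduction E s"
  then obtain E' where E': "weierstrass_equation_of E E'" "integral_at s E'" "val s (disc E') = 0"
    unfolding good_reduction_def minimal_equation_at_def by blast
  then have "disc E' \<noteq> 0" using disc_nonzero_weierstrass_equation_of assms by blast
  moreover from this E'(3) have "inverse (disc E') \<in> local_ring s"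
    by (simp add: mem_local_ring_iff val_inverse)
  ultimately show "\<exists>E'. weierstrass_equation_of E E' \<and> unimodular_at s E'"
    using E' unfolding unimodular_at_def by blast
next
  assume "\<exists>E'. weierstrass_equation_of E E' \<and> unimodular_at s E'"
  then obtain E' where E': "weierstrass_equation_of E E'" "integral_at s E'" "disc E' \<noteq> 0"
    "inverse (disc E') \<in> local_ring s" unfolding unimodular_at_def by blast
  have val: "val s (disc E'') \<ge> 0" if "weierstrass_equation_of E E''" "integral_at s E''" for E''
    using integral_disc[OF that(2)] disc_nonzero_weierstrass_equation_of[OF that(1) assms]
    by (simp add: mem_local_ring_iff)
  have "val s (disc E') = 0"
    using val[OF E'(1,2)] E'(3,4) by (simp add: mem_local_ring_iff val_inverse)
  moreover from this have "minimal_equation_at s E E'"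
    unfolding minimal_equation_at_def using E'(1,2) val by auto
  ultimately show "good_reduction E s"
    unfolding good_reduction_def by blast
qed

lemma good_reduction_weierstrass_equation_of:
  assumes "weierstrass_equation_of E E'" "disc E \<noteq> 0" "good_reduction E s"
  shows "good_reduction E' s"
proof -
  have "disc E' \<noteq> 0" using assms(1,2) by (rule disc_nonzero_weierstrass_equation_of)
  moreover obtain E1 where "weierstrass_equation_of E E1" "unimodular_at s E1"
    using assms(3) good_reduction_iff[OF assms(2)] by blast
  ultimately show ?thesis
    using good_reduction_iff weierstrass_equation_of_trans[OF weierstrass_equation_of_sym[OF assms(1)]]
    by blast
qed

section \<open>Gluing local equations\<close>

text \<open>
  A smooth model at the point \<open>p\<close> can be reached by a change of variables that is invertible at
  every other finite point. For the scaling factor this is the hypothesis on \<open>w\<close>. The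
  translations \<open>r\<close>, \<open>q\<close>, \<open>t\<close> may be altered by following up with any substitution integral at
  \<open>p\<close>, and by partial fractions such a substitution removes their poles away from \<open>p\<close>.
\<close>

lemma glue_local_equation:
  assumes E': "unimodular_at p (change_vars u r q t E)" and u: "u \<noteq> 0"
    and w: "w \<noteq> 0" "u / w \<in> local_ring p" "w / u \<in> local_ring p"
      "w \<in> regular_away p" "inverse w \<in> regular_away p"
  obtains E'' where "weierstrass_equation_of E E''" "unimodular_at p E''"
    "\<And>b. Aff b \<noteq> p \<Longrightarrow> unimodular_at (Aff b) E \<Longrightarrow> unimodular_at (Aff b) E''"
proof -
  have approx: "\<exists>g. g \<in> local_ring p \<and> f + w ^ n * g \<in> regular_away p" for f n
  proof -
    obtain g where "g \<in> local_ring p" "f * inverse w ^ n + g \<in> regular_away p"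
      using partial_fraction by blast
    moreover from this have "w ^ n * (f * inverse w ^ n + g) \<in> regular_away p"
      using w by (intro regular_away_mult regular_away_power)
    moreover have "w ^ n * (f * inverse w ^ n + g) = f + w ^ n * g"
      using w by (simp add: field_simps)
    ultimately show ?thesis by metis
  qed
  \<comment> \<open>The order matters: the pole part that \<open>t'\<close> removes already involves \<open>r'\<close>.\<close>
  obtain r' where r': "r' \<in> local_ring p" "r + w^2 * r' \<in> regular_away p"
    using approx by blast
  obtain q' where q': "q' \<in> local_ring p" "q + w^1 * q' \<in> regular_away p"
    using approx by blast
  obtain t' where t': "t' \<in> local_ring p" "t + w^2 * q * r' + w^3 * t' \<in> regular_away p"
    using approx by blast
  define E'' where "E'' = change_vars w (r + w^2 * r') (q + w * q') (t + w^2 * q * r' + w^3 * t') E"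
  have "E'' = change_vars 1 r' q' t' (change_vars w r q t E)"
    unfolding E''_def using w by (subst change_vars_compose) simp_all
  also have "change_vars w r q t E = change_vars (w / u) 0 0 0 (change_vars u r q t E)"
    using u w by (subst change_vars_compose) simp_all
  finally have "E'' = change_vars 1 r' q' t' (change_vars (w / u) 0 0 0 (change_vars u r q t E))" .
  then have "unimodular_at p E''"
    using E' u w r' q' t' by (auto intro!: unimodular_change_vars)
  moreover have "weierstrass_equation_of E E''"
    unfolding E''_def weierstrass_equation_of_def using w by blast
  moreover have "unimodular_at (Aff b) E''" if "Aff b \<noteq> p" "unimodular_at (Aff b) E" for b
    unfolding E''_def using that w r' q' t'
    by (intro unimodular_change_vars) (auto simp: regular_away_def)
  ultimately show ?thesis using that by blast
qed

lemma uniformizer_power: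
  assumes "u \<noteq> 0"
  obtains w where "w \<noteq> 0" "u / w \<in> local_ring (Aff a)" "w / u \<in> local_ring (Aff a)"
      "w \<in> regular_away (Aff a)" "inverse w \<in> regular_away (Aff a)"
proof -
  let ?\<pi> = "to_fract [:-a, 1:]"
  have \<pi>: "?\<pi> \<noteq> 0" by simp
  have v\<pi>: "val (Aff a) ?\<pi> = 1"
    using order_power_n_n[of a 1] by (simp add: to_fract_def val_Fract)
  have "?\<pi> \<in> regular_away (Aff a)" by (auto simp: regular_away_def)
  note reg = this regular_away_inverse_linear[of a]
  define n where "n = nat \<bar>val (Aff a) u\<bar>"
  define w where "w = (if val (Aff a) u \<ge> 0 then ?\<pi> ^ n else inverse ?\<pi> ^ n)"
  have "w \<noteq> 0" using \<pi> by (simp add: w_def)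
  moreover have "val (Aff a) w = val (Aff a) u"
    using \<pi> by (simp add: w_def val_power val_inverse n_def v\<pi>)
  moreover have "w \<in> regular_away (Aff a)" "inverse w \<in> regular_away (Aff a)"
    using reg unfolding w_def by (auto intro!: regular_away_power simp flip: power_inverse)
  ultimately show ?thesis using that[of w] assms
    by (simp add: mem_local_ring_iff divide_inverse val_mult val_inverse)
qed

lemma glue_affine:
  assumes "good_reduction E (Aff a)" "disc E \<noteq> 0"
  obtains E' where "weierstrass_equation_of E E'" "unimodular_at (Aff a) E'"
    "\<And>b. unimodular_at (Aff b) E \<Longrightarrow> unimodular_at (Aff b) E'"
proof -
  from assms obtain u r q t where E': "unimodular_at (Aff a) (change_vars u r q t E)" "u \<noteq> 0"
    unfolding good_reduction_iff[OF assms(2)] weierstrass_equation_of_def by blast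
  obtain w where w: "w \<noteq> 0" "u / w \<in> local_ring (Aff a)" "w / u \<in> local_ring (Aff a)"
      "w \<in> regular_away (Aff a)" "inverse w \<in> regular_away (Aff a)"
    using uniformizer_power[OF E'(2)] by blast
  obtain E'' where E'': "weierstrass_equation_of E E''" "unimodular_at (Aff a) E''"
      "\<And>b. Aff b \<noteq> Aff a \<Longrightarrow> unimodular_at (Aff b) E \<Longrightarrow> unimodular_at (Aff b) E''"
    using glue_local_equation[OF E' w] by blast
  then have "unimodular_at (Aff b) E''" if "unimodular_at (Aff b) E" for b
    using that by (cases "b = a") auto
  with E''(1,2) show ?thesis using that by blast
qed

text \<open>
  The polynomial ring has class number one, so that the local models glue to a single equation:
  repair the finitely many points where \<open>E\<close> itself is not a smooth model, one after the other.
\<close>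

lemma global_affine_equation:
  assumes "\<And>a. good_reduction E (Aff a)" "disc E \<noteq> 0"
  obtains E' where "weierstrass_equation_of E E'" "\<And>a. unimodular_at (Aff a) E'"
proof -
  let ?B = "\<lambda>E. {a. \<not> unimodular_at (Aff a) E}"
  have fin: "finite (?B E)"
  proof -
    have "?B E \<subseteq> (\<Union>f\<in>{a1 E, a2 E, a3 E, a4 E, a6 E, inverse (disc E)}. {a. f \<notin> local_ring (Aff a)})"
      using assms(2) by (auto simp: unimodular_at_def integral_at_iff)
    then show ?thesis by (rule finite_subset) (auto intro: finite_poles)
  qed
  have "\<exists>E'. weierstrass_equation_of E E' \<and> (\<forall>a. unimodular_at (Aff a) E')"
    using fin assms
  proof (induction "?B E" arbitrary: E rule: finite_psubset_induct)
    case psubset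
    show ?case
    proof (cases "?B E = {}")
      case True
      then show ?thesis using weierstrass_equation_of_refl by blast
    next
      case False
      then obtain a where a: "\<not> unimodular_at (Aff a) E" by blast
      obtain E1 where E1: "weierstrass_equation_of E E1" "unimodular_at (Aff a) E1"
          "\<And>b. unimodular_at (Aff b) E \<Longrightarrow> unimodular_at (Aff b) E1"
        using glue_affine[OF psubset.prems] by blast
      have "?B E1 \<subset> ?B E" using a E1(2,3) by blast
      moreover have "good_reduction E1 (Aff b)" "disc E1 \<noteq> 0" for b
        using E1(1) psubset.prems good_reduction_weierstrass_equation_of
          disc_nonzero_weierstrass_equation_of by blast+
      ultimately obtain E' where "weierstrass_equation_of E1 E'" "\<forall>a. unimodular_at (Aff a) E'"
        using psubset.hyps by blast
      then show ?thesis using E1(1) weierstrass_equation_of_trans by blast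
    qed
  qed
  then show ?thesis using that by blast
qed

lemma disc_constant:
  fixes E :: "'k::alg_closed_field poly fract weierstrass"
  assumes "\<And>a. unimodular_at (Aff a) E"
  obtains c where "disc E = to_fract [:c:]" "c \<noteq> 0"
proof -
  have "disc E \<in> local_ring (Aff a)" "inverse (disc E) \<in> local_ring (Aff a)" "disc E \<noteq> 0" for a
    using assms integral_disc by (auto simp: unimodular_at_def)
  then show ?thesis using unit_polynomial_constant[of "disc E"] that by blast
qed

text \<open>
  After gluing over the affine line the discriminant is a constant \<open>c\<close>. A smooth model at
  infinity then has a scaling factor \<open>u\<close> with \<open>u\<^sup>1\<^sup>2\<close> of valuation \<open>0\<close> there, so that it glues to the
  affine model with \<open>w = 1\<close>. The coefficients of the result have no poles at all, so they are
  constants.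
\<close>

theorem constant_if_good_reduction_everywhere:
  fixes E :: "'k::alg_closed_field poly fract weierstrass"
  assumes "elliptic_curve E" and good: "\<And>s. good_reduction E s"
  shows "constant_curve E"
proof -
  have "disc E \<noteq> 0" using assms(1) by (simp add: elliptic_curve_def)
  then obtain E1 where E1: "weierstrass_equation_of E E1" "\<And>a. unimodular_at (Aff a) E1"
    using global_affine_equation[OF good] by blast
  then obtain c where c: "disc E1 = to_fract [:c:]" "c \<noteq> 0" using disc_constant by blast
  then have "disc E1 \<noteq> 0" by simp
  moreover have "good_reduction E1 Infty"
    using good_reduction_weierstrass_equation_of[OF E1(1) \<open>disc E \<noteq> 0\<close> good] .
  ultimately obtain u r q t where u: "unimodular_at Infty (change_vars u r q t E1)" "u \<noteq> 0"
    using good_reduction_iff[of E1] unfolding weierstrass_equation_of_def by blast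
  define d where "d = disc (change_vars u r q t E1)"
  have "d \<noteq> 0" "d \<in> local_ring Infty" "inverse d \<in> local_ring Infty"
    using u(1) integral_disc unfolding d_def unimodular_at_def by auto
  then have "val Infty d = 0" by (simp add: mem_local_ring_iff val_inverse)
  moreover have "u^12 * d = disc E1" unfolding d_def by (rule disc_change_vars[OF u(2)])
  moreover have "val Infty (u^12 * d) = 12 * val Infty u + val Infty d"
    using u(2) \<open>d \<noteq> 0\<close> by (simp add: val_mult val_power)
  moreover have "val Infty (disc E1) = 0" unfolding c using c(2) by (simp add: to_fract_def val_Fract)
  ultimately have "val Infty u = 0" by simp
  then have unit: "u / 1 \<in> local_ring Infty" "1 / u \<in> local_ring Infty"
    using u(2) by (simp_all add: mem_local_ring_iff val_inverse divide_inverse)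
  have one: "(1 :: 'k poly fract) \<in> regular_away Infty" "inverse (1 :: 'k poly fract) \<in> regular_away Infty"
    by (auto simp: regular_away_def)
  obtain E2 where E2: "weierstrass_equation_of E1 E2" "unimodular_at Infty E2" "\<And>b. unimodular_at (Aff b) E2"
  proof (rule glue_local_equation[OF u one_neq_zero unit one])
    fix E2
    assume "weierstrass_equation_of E1 E2" "unimodular_at Infty E2"
      "\<And>b. Aff b \<noteq> Infty \<Longrightarrow> unimodular_at (Aff b) E1 \<Longrightarrow> unimodular_at (Aff b) E2"
    then show thesis using that E1(2) by simp
  qed
  have "integral_at s E2" for s
    using E2(2,3) by (cases s) (auto simp: unimodular_at_def)
  then have "set_weierstrass E2 \<subseteq> constants"
    unfolding integral_at_def mem_constants_iff subset_eq by blast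
  then show ?thesis
    unfolding constant_curve_def using E1(1) E2(1) weierstrass_equation_of_trans by blast
qed

section \<open>Frobenius descent\<close>

text \<open>
  Collect the linear factors into one \<open>n\<close>-th power; the leading coefficient is an \<open>n\<close>-th power
  because the field is algebraically closed.
\<close>

lemma perfect_power_if_orders_divisible:
  fixes h :: "'k::alg_closed_field poly"
  assumes "h \<noteq> 0" "n > 0" "\<And>a. n dvd order a h"
  obtains H where "h = H ^ n"
proof -
  have "\<exists>H. h = H ^ n"
    using assms
  proof (induction "degree h" arbitrary: h rule: less_induct)
    case less
    show ?case
    proof (cases "degree h = 0")
      case True
      then obtain c where "h = [:c:]" by (rule degree_eq_zeroE)
      moreover obtain b where "b ^ n = c" using nth_root_exists less.prems by blast
      ultimately show ?thesis by (intro exI[of _ "[:b:]"]) (simp add: poly_const_pow)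
    next
      case False
      then obtain a where a: "poly h a = 0" using alg_closed_imp_poly_has_root[of h] by blast
      let ?X = "[:-a, 1:]"
      obtain g where g: "h = ?X ^ order a h * g" "\<not> ?X dvd g" using order_decomp[OF less.prems(1)] by blast
      have g0: "g \<noteq> 0" using g by auto
      have pos: "order a h > 0" using a less.prems(1) by (simp add: order_gt_0_iff)
      have "degree h = order a h + degree g"
        by (subst g(1)) (simp add: degree_mult_eq g0 degree_power_eq)
      then have "degree g < degree h" using pos by simp
      moreover have "n dvd order b g" for b
      proof (cases "b = a")
        case True
        then show ?thesis using g(2) by (simp add: order_0I poly_eq_0_iff_dvd)
      next
        case False
        have "order b h = order b (?X ^ order a h) + order b g"
          by (subst g(1), subst order_mult) (use g0 in auto)
        also have "order b (?X ^ order a h) = 0" using False by (intro order_0I) simp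
        finally show ?thesis using less.prems(3) by (metis add_0)
      qed
      ultimately obtain G where "g = G ^ n" using less.hyps g0 less.prems(2) by blast
      moreover obtain m where "order a h = n * m" using less.prems(3) by (auto elim: dvdE)
      ultimately have "h = (?X ^ m * G) ^ n"
        using g(1) by (metis power_mult power_mult_distrib mult.commute)
      then show ?thesis by blast
    qed
  qed
  then show ?thesis using that by blast
qed

lemma dvd_if_power_dvd_power:
  fixes f g :: "'k::alg_closed_field poly"
  assumes "f ^ n dvd g ^ n" "n > 0"
  shows "f dvd g"
  using assms
proof (induction "degree f" arbitrary: f g rule: less_induct)
  case less
  show ?case
  proof (cases "f = 0 \<or> degree f = 0")
    case True
    then show ?thesis
    proof
      assume "f = 0"
      then show ?thesis using less.prems by (simp add: zero_power)
    next
      assume "degree f = 0"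
      then obtain c where "f = [:c:]" by (rule degree_eq_zeroE)
      then show ?thesis using less.prems
        by (cases "c = 0") (auto simp: zero_power const_poly_dvd_iff dvd_field_iff)
    qed
  next
    case False
    then obtain a where "poly f a = 0" using alg_closed_imp_poly_has_root[of f] by blast
    then obtain f1 where f1: "f = [:-a, 1:] * f1" unfolding poly_eq_0_iff_dvd by (auto elim: dvdE)
    have "f dvd g ^ n" using less.prems by (metis dvd_power dvd_trans)
    then have "poly (g ^ n) a = 0" using \<open>poly f a = 0\<close> by (metis dvd_trans poly_eq_0_iff_dvd)
    then have "poly g a = 0" by simp
    then obtain g1 where g1: "g = [:-a, 1:] * g1" unfolding poly_eq_0_iff_dvd by (auto elim: dvdE)
    have "degree f1 < degree f" using False f1 by (auto simp: degree_mult_eq simp del: mult_pCons_left)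
    moreover have "f1 ^ n dvd g1 ^ n"
      using less.prems unfolding f1 g1 power_mult_distrib by (subst (asm) dvd_mult_cancel_left) auto
    ultimately have "f1 dvd g1" using less by blast
    then show ?thesis unfolding f1 g1 by (rule mult_dvd_mono[OF dvd_refl])
  qed
qed

lemma order_power: "p \<noteq> 0 \<Longrightarrow> order a (p ^ n) = n * order a p" for p :: "'k::idom poly"
  by (induction n) (auto simp: order_mult)

lemma binomial_two_terms:
  fixes d x :: "'a::comm_ring_1"
  shows "x^2 dvd (d + x) ^ i - (d ^ i + of_nat i * d ^ (i - 1) * x)"
proof (induction i)
  case (Suc i)
  have "(d + x) ^ Suc i - (d ^ Suc i + of_nat (Suc i) * d ^ i * x) =
        (d + x) * ((d + x) ^ i - (d ^ i + of_nat i * d ^ (i - 1) * x)) + of_nat i * d ^ (i - 1) * x^2"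
    by (cases i) (simp_all add: algebra_simps power2_eq_square)
  then show ?case using Suc by (simp add: dvd_add)
qed auto

text \<open>
  The polynomial heart of the bound for curves with non-constant \<open>j\<close>-invariant. With
  \<open>\<delta>\<^sup>q = -\<beta>\<close> and \<open>w = g - \<delta>\<close> the additivity of Frobenius turns the hypothesis into
  \<open>h\<^sup>q dvd w\<^sup>q + \<alpha> h\<^sup>q\<^sup>-\<^sup>1 (\<delta> + w)\<^sup>i\<close>. At a root of \<open>h\<close> the polynomial \<open>w\<close> vanishes, hence \<open>\<delta> + w\<close>
  does not, and the two summands must have the same order there: \<open>q\<close> times the order of \<open>w\<close> is
  \<open>q - 1\<close> times that of \<open>h\<close>. Therefore \<open>h\<close> is a \<open>q\<close>-th power \<open>H\<^sup>q\<close> and \<open>w = H\<^sup>q\<^sup>-\<^sup>1 G\<close>. Dividing by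
  \<open>H\<close> to the power \<open>q (q - 1)\<close> and expanding \<open>(\<delta> + w)\<^sup>i\<close> up to first order gives a relation of the
  same shape for \<open>H\<close> and \<open>G\<close>, with exponent \<open>1\<close> and new constants \<open>\<alpha> i \<delta>\<^sup>i\<^sup>-\<^sup>1\<close> and \<open>\<alpha> \<delta>\<^sup>i\<close>. Since
  the degree drops by the factor \<open>q\<close>, it was \<open>0\<close>.
\<close>

theorem frobenius_descent:
  fixes g h :: "'k::alg_closed_field poly"
  assumes p: "prime CHAR('k)" and q: "q = CHAR('k) ^ n" "n > 0"
    and "\<alpha> \<noteq> 0" "\<beta> \<noteq> 0" "\<not> CHAR('k) dvd i"
    and "h ^ q dvd g ^ q + smult \<alpha> (h ^ (q - 1) * g ^ i) + [:\<beta>:]"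
  shows "degree h = 0"
  using assms(4-)
proof (induction "degree h" arbitrary: g h \<alpha> \<beta> i rule: less_induct)
  case less
  show ?case
  proof (rule ccontr)
    assume deg: "degree h \<noteq> 0"
    then have h0: "h \<noteq> 0" by auto
    have q2: "q \<ge> 2"
      using q p prime_ge_2_nat[OF p] self_le_power[of "CHAR('k)" n] by simp
    then have q0: "q > 0" and q1: "q - 1 > 0" by auto
    have pp: "prime CHAR('k poly)" using p by simp
    have frob: "(x + y) ^ q = x ^ q + y ^ q" for x y :: "'k poly"
      by (rule freshmans_dream'[OF pp, of _ n]) (simp add: q)
    obtain \<delta> where "\<delta> ^ q = - \<beta>" using nth_root_exists[OF q0] by blast
    then have \<delta>: "[:\<delta>:] ^ q + [:\<beta>:] = 0" "\<delta> \<noteq> 0"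
      using less.prems(2) q2 by (auto simp: poly_const_pow zero_power)
    define w where "w = g - [:\<delta>:]"
    have g: "g = [:\<delta>:] + w" by (simp add: w_def)
    have gw: "g ^ q + [:\<beta>:] = w ^ q"
      unfolding g frob using \<delta>(1) by (simp add: algebra_simps)
    then have dvd: "h ^ q dvd w ^ q + smult \<alpha> (h ^ (q - 1) * g ^ i)"
      using less.prems(4) unfolding gw[symmetric] by (simp only: ac_simps)
    have hq: "h ^ q = h ^ (q - 1) * h" using q2 by (simp flip: power_Suc2)
    have w_root: "poly w a = 0" if "poly h a = 0" for a
    proof -
      have "h ^ (q - 1) dvd h ^ q" using hq by simp
      then have "h ^ (q - 1) dvd w ^ q + smult \<alpha> (h ^ (q - 1) * g ^ i)" using dvd dvd_trans by blast
      then have "h ^ (q - 1) dvd w ^ q" by (simp add: dvd_add_left_iff dvd_smult)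
      moreover have "poly (h ^ (q - 1)) a = 0" using that q2 by simp
      ultimately have "poly (w ^ q) a = 0" by (metis dvd_trans poly_eq_0_iff_dvd)
      then show ?thesis by simp
    qed
    \<comment> \<open>If the orders of the two summands differed, the smaller one would be the order of the sum;
      but \<open>(q - 1) m\<close> is too small for a multiple of \<open>h\<^sup>q\<close>.\<close>
    have orders: "q * order a w = (q - 1) * order a h \<and> w \<noteq> 0" if "poly h a = 0" for a
    proof -
      let ?m = "order a h"
      define y where "y = smult \<alpha> (h ^ (q - 1) * g ^ i)"
      have ga: "poly g a \<noteq> 0" using w_root[OF that] \<delta>(2) by (simp add: g)
      have gi: "g ^ i \<noteq> 0" using ga by auto
      have y0: "y \<noteq> 0" using gi h0 less.prems(1) by (simp add: y_def)
      have oy: "order a y = (q - 1) * ?m"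
        using less.prems(1) h0 gi ga by (simp add: y_def order_smult order_mult order_power order_0I)
      have m: "?m > 0" using that h0 by (simp add: order_gt_0_iff)
      have less: "(q - 1) * ?m < q * ?m" using m q2 by simp
      have X: "[:-a, 1:] ^ (q * ?m) dvd w ^ q + y"
        using dvd_trans[OF dvd_power_same[OF order_1[of a h], of q] dvd]
        by (simp only: power_mult [symmetric] mult.commute y_def)
      have Xy: "[:-a, 1:] ^ k dvd y \<longleftrightarrow> k \<le> (q - 1) * ?m" for k
        unfolding order_divides oy using y0 by blast
      have "w ^ q \<noteq> 0"
      proof
        assume "w ^ q = 0"
        then show False using X less unfolding \<open>w ^ q = 0\<close> add_0 Xy by linarith
      qed
      have Xw: "[:-a, 1:] ^ k dvd w ^ q \<longleftrightarrow> k \<le> q * order a w" for k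
        using \<open>w ^ q \<noteq> 0\<close> q0 by (auto simp: order_divides order_power)
      have le: "[:-a, 1:] ^ k dvd w ^ q + y" if "k \<le> q * ?m" for k
        using X that le_imp_power_dvd dvd_trans by blast
      have "(q - 1) * ?m \<le> q * order a w"
        using le[of "(q - 1) * ?m"] less Xy[of "(q - 1) * ?m"] Xw[of "(q - 1) * ?m"]
        by (simp add: dvd_add_left_iff)
      moreover have "\<not> Suc ((q - 1) * ?m) \<le> q * order a w"
      proof
        assume "Suc ((q - 1) * ?m) \<le> q * order a w"
        then have "[:-a, 1:] ^ Suc ((q - 1) * ?m) dvd w ^ q" unfolding Xw .
        moreover have "[:-a, 1:] ^ Suc ((q - 1) * ?m) dvd w ^ q + y"
          using less by (intro le) linarith
        ultimately have "[:-a, 1:] ^ Suc ((q - 1) * ?m) dvd y"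
          using dvd_add_right_iff by blast
        then show False unfolding Xy by simp
      qed
      ultimately show ?thesis using \<open>w ^ q \<noteq> 0\<close> q2 by auto
    qed
    have "q dvd order a h" for a
    proof (cases "poly h a = 0")
      case True
      have "coprime q (q - 1)" using coprime_Suc_left_nat[of "q - 1"] q0 by simp
      moreover have "q dvd (q - 1) * order a h" using orders[OF True] by (metis dvd_triv_left)
      ultimately show ?thesis by (simp add: coprime_dvd_mult_right_iff)
    qed (simp add: order_0I)
    then obtain H where H: "h = H ^ q" using perfect_power_if_orders_divisible[OF h0 q0] by blast
    have H0: "H \<noteq> 0" using h0 H q2 by (auto simp: zero_power)
    have "(H ^ (q - 1)) ^ q dvd w ^ q"
    proof -
      have "(H ^ (q - 1)) ^ q = h ^ (q - 1)"
        unfolding H by (simp only: power_mult [symmetric] mult.commute)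
      moreover have "h ^ (q - 1) dvd w ^ q + smult \<alpha> (h ^ (q - 1) * g ^ i)"
        using dvd hq by (metis dvd_mult_left)
      ultimately show ?thesis by (simp add: dvd_add_left_iff dvd_smult)
    qed
    then have "H ^ (q - 1) dvd w" using q0 by (rule dvd_if_power_dvd_power)
    then obtain G where G: "w = H ^ (q - 1) * G" by (auto elim: dvdE)
    define x where "x = H ^ (q - 1) * G"
    have "H ^ q dvd x ^ 2"
    proof -
      \<comment> \<open>As \<open>q\<close> is at least \<open>2\<close>, terms of order two in \<open>x\<close> vanish modulo \<open>H\<^sup>q\<close>.\<close>
      have "q \<le> (q - 1) * 2" using q2 by simp
      then have "H ^ q dvd (H ^ (q - 1)) ^ 2" by (metis le_imp_power_dvd power_mult)
      then show ?thesis unfolding x_def power_mult_distrib by simp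
    qed
    then have binom: "H ^ q dvd ([:\<delta>:] + x) ^ i - ([:\<delta>:] ^ i + of_nat i * [:\<delta>:] ^ (i - 1) * x)"
      using binomial_two_terms dvd_trans by blast
    have hH1: "h ^ (q - 1) = (H ^ (q - 1)) ^ q"
      unfolding H by (simp only: power_mult [symmetric] mult.commute)
    have hH2: "h ^ q = (H ^ (q - 1)) ^ q * H ^ q"
      unfolding hq hH1 by (simp only: H)
    have w_eq: "w ^ q + smult \<alpha> (h ^ (q - 1) * g ^ i) = (H ^ (q - 1)) ^ q * (G ^ q + smult \<alpha> (([:\<delta>:] + x) ^ i))"
      unfolding hH1 g G x_def power_mult_distrib by (simp only: distrib_left mult_smult_right)
    have 1: "H ^ q dvd G ^ q + smult \<alpha> (([:\<delta>:] + x) ^ i)"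
      using dvd H0 unfolding w_eq hH2 by (subst (asm) dvd_mult_cancel_left) auto
    have "H ^ q dvd G ^ q + smult \<alpha> ([:\<delta>:] ^ i + of_nat i * [:\<delta>:] ^ (i - 1) * x)"
      using dvd_diff[OF 1 dvd_smult[OF binom, of \<alpha>]] by (simp add: smult_diff_right)
    also have "smult \<alpha> ([:\<delta>:] ^ i + of_nat i * [:\<delta>:] ^ (i - 1) * x) =
      smult (\<alpha> * of_nat i * \<delta> ^ (i - 1)) (H ^ (q - 1) * G ^ 1) + [:\<alpha> * \<delta> ^ i:]"
      by (simp add: x_def poly_const_pow of_nat_poly smult_add_right mult_ac)
    finally have "H ^ q dvd G ^ q + smult (\<alpha> * of_nat i * \<delta> ^ (i - 1)) (H ^ (q - 1) * G ^ 1) + [:\<alpha> * \<delta> ^ i:]"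
      by (simp add: add.assoc)
    moreover have "\<alpha> * of_nat i * \<delta> ^ (i - 1) \<noteq> 0" "\<alpha> * \<delta> ^ i \<noteq> 0"
      using less.prems \<delta>(2) by (auto simp: of_nat_eq_0_iff_char_dvd)
    moreover have "\<not> CHAR('k) dvd 1" using p by (metis not_prime_unit)
    moreover have degH: "degree h = q * degree H" unfolding H using H0 by (simp add: degree_power_eq)
    then have "degree H < degree h" using deg q2 by simp
    ultimately have "degree H = 0" using less.hyps by blast
    then show False using degH deg by simp
  qed
qed

section \<open>Good reduction on the affine line\<close>

lemma fract_char_zero: "of_nat CHAR('k) = (0 :: 'k::field poly fract)"
proof -
  have "of_nat CHAR('k) = (0 :: 'k poly)" by (metis of_nat_CHAR semiring_char_poly)
  then show ?thesis by (simp add: of_nat_fract fract_collapse)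
qed

lemma to_fract_power [simp]: "to_fract (x ^ n) = to_fract x ^ n"
  by (induction n) auto

text \<open>
  The coefficients are polynomials and the discriminant is a constant \<open>c\<close>. Reading the formula for
  the discriminant modulo the characteristic gives an instance of Frobenius descent:
  \<open>a1\<^sup>4 dvd a3\<^sup>4 + a1\<^sup>3 a3\<^sup>3 - c\<close> in characteristic \<open>2\<close>, and
  \<open>b2\<^sup>3 dvd b4\<^sup>3 + b2\<^sup>2 b4\<^sup>2 - c\<close> in characteristic \<open>3\<close>. Hence \<open>a1\<close>, respectively \<open>b2\<close>, is constant,
  and \<open>c4\<close> is a power of it.
\<close>

theorem j_constant_if_good_reduction_affine:
  fixes E :: "'k::alg_closed_field poly fract weierstrass"
  assumes char: "CHAR('k) = 2 \<or> CHAR('k) = 3" and E: "\<And>a. unimodular_at (Aff a) E"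
  shows "j_invariant E \<in> constants"
proof -
  obtain c where c: "disc E = to_fract [:c:]" "c \<noteq> 0" using disc_constant[OF E] by blast
  have int: "integral_at (Aff a) E" for a using E by (simp add: unimodular_at_def)
  note poly = pole_free_imp_polynomial
  obtain p1 where p1: "a1 E = to_fract p1" using poly[of "a1 E"] int by (auto simp: integral_at_iff)
  obtain p3 where p3: "a3 E = to_fract p3" using poly[of "a3 E"] int by (auto simp: integral_at_iff)
  obtain B2 where B2: "b2 E = to_fract B2" using poly[of "b2 E"] integral_b[OF int] by blast
  obtain B4 where B4: "b4 E = to_fract B4" using poly[of "b4 E"] integral_b[OF int] by blast
  obtain B6 where B6: "b6 E = to_fract B6" using poly[of "b6 E"] integral_b[OF int] by blast
  obtain B8 where B8: "b8 E = to_fract B8" using poly[of "b8 E"] integral_b[OF int] by blast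
  have minus_c: "[:- c:] = - [:c:]" by simp
  have "\<exists>b. c4 E = to_fract [:b:]"
    using char
  proof
    assume two: "CHAR('k) = 2"
    then have z: "(2 :: 'k poly fract) = 0" using fract_char_zero[where ?'k = 'k] by simp
    \<comment> \<open>The signs of the odd coefficients are chosen so that the relation for the discriminant
      below becomes a polynomial identity over the integers.\<close>
    have "(4 :: 'k poly fract) = 2 * 2" "(8 :: 'k poly fract) = 2 * 4" "(24 :: 'k poly fract) = 2 * 12"
      "(27 :: 'k poly fract) = 2 * 14 - 1" "(9 :: 'k poly fract) = 2 * 4 + 1"
      by simp_all
    then have num: "(4 :: 'k poly fract) = 0" "(8 :: 'k poly fract) = 0" "(24 :: 'k poly fract) = 0"
      "(27 :: 'k poly fract) = - 1" "(9 :: 'k poly fract) = 1"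
      by (simp_all only: z mult_zero_left diff_0 add_0)
    have b2: "b2 E = a1 E ^ 2" by (simp add: b2_def num)
    have "a3 E ^ 4 + a1 E ^ 3 * a3 E ^ 3 - disc E = a1 E ^ 4 * b8 E"
      unfolding disc_def b2 b4_def b6_def num z by algebra
    then have "to_fract (p3 ^ 4 + p1 ^ 3 * p3 ^ 3 - [:c:]) = to_fract (p1 ^ 4 * B8)"
      by (simp add: p1 p3 B8 c)
    then have "p1 ^ 4 dvd p3 ^ 4 + p1 ^ 3 * p3 ^ 3 - [:c:]"
      unfolding to_fract_eq_iff by simp
    then have "p1 ^ 4 dvd p3 ^ 4 + smult 1 (p1 ^ (4 - 1) * p3 ^ 3) + [:- c:]"
      by (simp add: minus_c del: minus_pCons)
    then have "degree p1 = 0"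
      using two c(2) by (intro frobenius_descent[where n = 2 and q = 4 and i = 3 and \<alpha> = 1 and \<beta> = "- c" and g = p3]) auto
    then obtain b where "p1 = [:b:]" by (rule degree_eq_zeroE)
    then have "b2 E = to_fract [:b ^ 2:]" by (simp add: b2 p1 poly_const_pow flip: to_fract_power)
    moreover have "c4 E = b2 E ^ 2" by (simp add: c4_def num)
    ultimately have "c4 E = to_fract [:(b ^ 2) ^ 2:]" by (simp add: poly_const_pow flip: to_fract_power)
    then show ?thesis by blast
  next
    assume three: "CHAR('k) = 3"
    then have z: "(3 :: 'k poly fract) = 0" using fract_char_zero[where ?'k = 'k] by simp
    have "(4 :: 'k poly fract) = 3 + 1" "(8 :: 'k poly fract) = 3 * 3 - 1" "(24 :: 'k poly fract) = 3 * 8"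
      "(27 :: 'k poly fract) = 3 * 9" "(9 :: 'k poly fract) = 3 * 3" "(2 :: 'k poly fract) = 3 - 1"
      by simp_all
    then have num: "(4 :: 'k poly fract) = 1" "(8 :: 'k poly fract) = - 1" "(24 :: 'k poly fract) = 0"
      "(27 :: 'k poly fract) = 0" "(9 :: 'k poly fract) = 0" "(2 :: 'k poly fract) = - 1"
      by (simp_all only: z mult_zero_left diff_0 add_0)
    have b8: "b8 E = b2 E * b6 E - b4 E ^ 2"
    proof -
      have "4 * b8 E = b2 E * b6 E - b4 E ^ 2"
        unfolding b8_def b2_def b4_def b6_def by algebra
      then show ?thesis by (simp add: num)
    qed
    have "b4 E ^ 3 + b2 E ^ 2 * b4 E ^ 2 - disc E = b2 E ^ 3 * b6 E"
      unfolding disc_def b8 num by algebra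
    then have "to_fract (B4 ^ 3 + B2 ^ 2 * B4 ^ 2 - [:c:]) = to_fract (B2 ^ 3 * B6)"
      by (simp add: B2 B4 B6 c)
    then have "B2 ^ 3 dvd B4 ^ 3 + B2 ^ 2 * B4 ^ 2 - [:c:]"
      unfolding to_fract_eq_iff by simp
    then have "B2 ^ 3 dvd B4 ^ 3 + smult 1 (B2 ^ (3 - 1) * B4 ^ 2) + [:- c:]"
      by (simp add: minus_c del: minus_pCons)
    then have "degree B2 = 0"
      using three c(2) by (intro frobenius_descent[where n = 1 and q = 3 and i = 2 and \<alpha> = 1 and \<beta> = "- c" and g = B4]) auto
    then obtain b where "B2 = [:b:]" by (rule degree_eq_zeroE)
    moreover have "c4 E = b2 E ^ 2" by (simp add: c4_def num)
    ultimately have "c4 E = to_fract [:b ^ 2:]" by (simp add: B2 poly_const_pow flip: to_fract_power)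
    then show ?thesis by blast
  qed
  then obtain b where "c4 E = to_fract [:b:]" by blast
  moreover have "inverse (to_fract [:c:]) = to_fract [:inverse c:]"
  proof (rule inverse_unique)
    have "to_fract [:c:] * to_fract [:inverse c:] = to_fract [:1:]"
      using c(2) by (simp flip: to_fract_mult)
    then show "to_fract [:c:] * to_fract [:inverse c:] = 1" by (simp flip: one_pCons)
  qed
  ultimately have "j_invariant E = to_fract [:b:] ^ 3 * to_fract [:inverse c:]"
    using c by (simp add: j_invariant_def divide_inverse)
  then show ?thesis
    unfolding mem_constants_iff by (auto intro!: local_ring_intros)
qed

theorem j_constant_if_bad_only_at_Infty:
  fixes E :: "'k::alg_closed_field poly fract weierstrass"
  assumes "CHAR('k) = 2 \<or> CHAR('k) = 3" "disc E \<noteq> 0" "\<And>a. good_reduction E (Aff a)"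
  shows "j_invariant E \<in> constants"
proof -
  obtain E' where "weierstrass_equation_of E E'" "\<And>a. unimodular_at (Aff a) E'"
    using global_affine_equation[OF assms(3,2)] by blast
  then show ?thesis
    using j_constant_if_good_reduction_affine[OF assms(1)] j_invariant_weierstrass_equation_of by metis
qed

section \<open>Moving a point to infinity\<close>

text \<open>
  Evaluation of a polynomial at \<open>a + 1/T\<close>, by Horner's scheme.
\<close>

definition mobius_poly :: "'k::field \<Rightarrow> 'k poly \<Rightarrow> 'k poly fract" where
  "mobius_poly a p = fold_coeffs (\<lambda>c f. to_fract [:c:] + (to_fract [:a:] + inverse (to_fract [:0, 1:])) * f) p 0"

lemma mobius_poly_0 [simp]: "mobius_poly a 0 = 0"
  by (simp add: mobius_poly_def)

lemma mobius_poly_pCons [simp]: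
  "mobius_poly a (pCons c p) = to_fract [:c:] + (to_fract [:a:] + inverse (to_fract [:0, 1:])) * mobius_poly a p"
  by (cases "p = 0 \<and> c = 0") (auto simp: mobius_poly_def)

lemma mobius_poly_add: "mobius_poly a (p + q) = mobius_poly a p + mobius_poly a q"
proof (induction p q rule: poly_induct2)
  case (pCons c p d q)
  have "to_fract [:c + d:] = to_fract [:c:] + to_fract [:d:]" by (simp flip: to_fract_add)
  with pCons show ?case by (simp add: algebra_simps)
qed auto

lemma mobius_poly_smult: "mobius_poly a (smult c p) = to_fract [:c:] * mobius_poly a p"
proof (induction p)
  case (pCons d p)
  have "to_fract [:c * d:] = to_fract [:c:] * to_fract [:d:]" by (simp flip: to_fract_mult)
  with pCons show ?case by (simp add: algebra_simps)
qed auto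

lemma mobius_poly_mult: "mobius_poly a (p * q) = mobius_poly a p * mobius_poly a q"
  by (induction p) (simp_all add: mobius_poly_add mobius_poly_smult algebra_simps)

text \<open>
  Clearing the denominator \<open>T\<^sup>n\<close> from \<open>p (a + 1/T)\<close> leaves a polynomial \<open>h\<close> whose values are known:
  away from \<open>0\<close> by substitution, and at \<open>0\<close>, the image of infinity, as the coefficient of degree
  \<open>n\<close>. This controls both kinds of local rings under the substitution.
\<close>

lemma mobius_poly_homogenize:
  assumes "degree p \<le> n"
  obtains h where "mobius_poly a p * to_fract [:0, 1:] ^ n = to_fract h"
    "\<And>b. b \<noteq> 0 \<Longrightarrow> poly h b = b ^ n * poly p (a + inverse b)" "poly h 0 = coeff p n"
proof -
  have "\<exists>h. mobius_poly a p * to_fract [:0, 1:] ^ n = to_fract h \<and>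
    (\<forall>b. b \<noteq> 0 \<longrightarrow> poly h b = b ^ n * poly p (a + inverse b)) \<and> poly h 0 = coeff p n"
    using assms
  proof (induction p arbitrary: n)
    case 0
    then show ?case by (intro exI[of _ 0]) auto
  next
    case (pCons c p)
    show ?case
    proof (cases n)
      case 0
      with pCons.prems have "p = 0" by (auto split: if_splits)
      then show ?thesis using 0 by (intro exI[of _ "[:c:]"]) auto
    next
      case (Suc m)
      with pCons.prems have "degree p \<le> m" by (auto split: if_splits)
      then obtain h where h: "mobius_poly a p * to_fract [:0, 1:] ^ m = to_fract h"
        "\<And>b. b \<noteq> 0 \<Longrightarrow> poly h b = b ^ m * poly p (a + inverse b)" "poly h 0 = coeff p m"
        using pCons.IH by metis
      let ?X = "to_fract [:0, 1 :: 'a:]"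
      have X: "?X \<noteq> 0" by simp
      have "mobius_poly a (pCons c p) * ?X ^ n =
            to_fract [:c:] * ?X ^ n + (to_fract [:a:] * ?X + 1) * (mobius_poly a p * ?X ^ m)"
        unfolding Suc using X by (simp add: field_simps)
      also have "\<dots> = to_fract ([:c:] * [:0, 1:] ^ n + ([:a:] * [:0, 1:] + 1) * h)"
        unfolding h(1) by (simp only: to_fract_add to_fract_mult to_fract_power to_fract_1)
      finally have "mobius_poly a (pCons c p) * ?X ^ n = \<dots>" .
      moreover have "poly ([:c:] * [:0, 1:] ^ n + ([:a:] * [:0, 1:] + 1) * h) b
          = b ^ n * poly (pCons c p) (a + inverse b)" if "b \<noteq> 0" for b
        using that h(2)[OF that] by (simp add: Suc field_simps)
      moreover have "poly ([:c:] * [:0, 1:] ^ n + ([:a:] * [:0, 1:] + 1) * h) 0 = coeff (pCons c p) n"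
        using h(3) by (simp add: Suc)
      ultimately show ?thesis by blast
    qed
  qed
  then show ?thesis using that by blast
qed

lemma mobius_poly_nonzero: "mobius_poly a p \<noteq> 0" if "p \<noteq> 0"
proof
  assume *: "mobius_poly a p = 0"
  obtain h where "mobius_poly a p * to_fract [:0, 1:] ^ degree p = to_fract h"
    "poly h 0 = coeff p (degree p)"
    using mobius_poly_homogenize[OF order.refl] by metis
  with * that show False by auto
qed

text \<open>
  The endomorphism of \<open>k(T)\<close> with \<open>T \<mapsto> a + 1/T\<close>. The point \<open>Aff a\<close> corresponds to infinity.
\<close>

definition mobius :: "'k::field \<Rightarrow> 'k poly fract \<Rightarrow> 'k poly fract" where
  "mobius a f = (THE g. \<exists>p q. q \<noteq> 0 \<and> f = Fract p q \<and> g = mobius_poly a p / mobius_poly a q)"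

lemma mobius_Fract: "mobius a (Fract p q) = mobius_poly a p / mobius_poly a q" if "q \<noteq> 0"
  unfolding mobius_def
proof (rule the_equality)
  show "\<exists>p' q'. q' \<noteq> 0 \<and> Fract p q = Fract p' q' \<and>
          mobius_poly a p / mobius_poly a q = mobius_poly a p' / mobius_poly a q'"
    using that by blast
next
  fix g
  assume "\<exists>p' q'. q' \<noteq> 0 \<and> Fract p q = Fract p' q' \<and> g = mobius_poly a p' / mobius_poly a q'"
  then obtain p' q' where *: "q' \<noteq> 0" "Fract p q = Fract p' q'" "g = mobius_poly a p' / mobius_poly a q'"
    by blast
  then have "p * q' = p' * q" using that by (simp add: eq_fract)
  then have "mobius_poly a p * mobius_poly a q' = mobius_poly a p' * mobius_poly a q"
    by (metis mobius_poly_mult)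
  then show "g = mobius_poly a p / mobius_poly a q"
    using * that by (simp add: frac_eq_eq mobius_poly_nonzero)
qed

lemma mobius_const [simp]: "mobius a (to_fract [:c:]) = to_fract [:c:]"
proof -
  have one: "to_fract [:1 :: 'a:] = 1" by (simp flip: one_pCons)
  have "mobius a (Fract [:c:] [:1:]) = to_fract [:c:]" by (simp add: mobius_Fract one)
  then show ?thesis by (simp add: Fract_conv_to_fract one)
qed

lemma mobius_0 [simp]: "mobius a 0 = 0"
  using mobius_const[of a 0] by simp

lemma mobius_1 [simp]: "mobius a 1 = 1"
  using mobius_const[of a 1] by (simp flip: one_pCons)

lemma mobius_add: "mobius a (f + g) = mobius a f + mobius a g"
proof -
  obtain p q where f: "f = Fract p q" "q \<noteq> 0" by (cases f) auto
  obtain p' q' where g: "g = Fract p' q'" "q' \<noteq> 0" by (cases g) auto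
  show ?thesis using f g
    by (simp add: mobius_Fract mobius_poly_add mobius_poly_mult mobius_poly_nonzero add_frac_eq)
qed

lemma mobius_mult: "mobius a (f * g) = mobius a f * mobius a g"
proof -
  obtain p q where f: "f = Fract p q" "q \<noteq> 0" by (cases f) auto
  obtain p' q' where g: "g = Fract p' q'" "q' \<noteq> 0" by (cases g) auto
  show ?thesis using f g by (simp add: mobius_Fract mobius_poly_mult)
qed

lemma mobius_minus: "mobius a (- f) = - mobius a f"
  using mobius_add[of a f "- f"] by (simp add: eq_neg_iff_add_eq_0 add.commute)

lemma mobius_diff: "mobius a (f - g) = mobius a f - mobius a g"
  using mobius_add[of a f "- g"] by (simp add: mobius_minus)

lemma mobius_eq_0_iff [simp]: "mobius a f = 0 \<longleftrightarrow> f = 0"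
proof
  assume *: "mobius a f = 0"
  show "f = 0"
  proof (rule ccontr)
    assume "f \<noteq> 0"
    then have "mobius a f * mobius a (inverse f) = 1" by (simp flip: mobius_mult)
    with * show False by simp
  qed
qed simp

lemma mobius_inverse: "mobius a (inverse f) = inverse (mobius a f)"
proof (cases "f = 0")
  case False
  then have "mobius a f * mobius a (inverse f) = 1" by (simp flip: mobius_mult)
  then show ?thesis by (metis inverse_unique)
qed simp

lemma mobius_divide: "mobius a (f / g) = mobius a f / mobius a g"
  by (simp add: divide_inverse mobius_mult mobius_inverse)

lemma mobius_power: "mobius a (f ^ n) = mobius a f ^ n"
  by (induction n) (simp_all add: mobius_mult)

lemma mobius_numeral [simp]: "mobius a (numeral n) = numeral n"
  by (induction n) (simp_all only: numeral.simps mobius_1 mobius_add)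

lemmas mobius_hom = mobius_add mobius_mult mobius_minus mobius_diff mobius_divide mobius_power

lemma mobius_change_vars:
  "map_weierstrass (mobius a) (change_vars u r s t E) =
   change_vars (mobius a u) (mobius a r) (mobius a s) (mobius a t) (map_weierstrass (mobius a) E)"
  by (cases E) (simp add: change_vars_def mobius_hom)

lemma mobius_disc: "disc (map_weierstrass (mobius a) E) = mobius a (disc E)"
  by (cases E) (simp add: disc_def b2_def b4_def b6_def b8_def mobius_hom)

lemma mobius_c4: "c4 (map_weierstrass (mobius a) E) = mobius a (c4 E)"
  by (cases E) (simp add: c4_def b2_def b4_def mobius_hom)

lemma mobius_j_invariant: "j_invariant (map_weierstrass (mobius a) E) = mobius a (j_invariant E)"
  by (simp add: j_invariant_def mobius_disc mobius_c4 mobius_hom)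

lemma mobius_Fract_local_ring:
  assumes "degree p \<le> n" "degree q \<le> n" "q \<noteq> 0"
    and "b = 0 \<Longrightarrow> coeff q n \<noteq> 0" "b \<noteq> 0 \<Longrightarrow> poly q (a + inverse b) \<noteq> 0"
  shows "mobius a (Fract p q) \<in> local_ring (Aff b)"
proof -
  let ?X = "to_fract [:0, 1 :: 'a:]"
  obtain g where g: "mobius_poly a p * ?X ^ n = to_fract g"
    using mobius_poly_homogenize[OF assms(1)] by metis
  obtain h where h: "mobius_poly a q * ?X ^ n = to_fract h"
    "\<And>b. b \<noteq> 0 \<Longrightarrow> poly h b = b ^ n * poly q (a + inverse b)" "poly h 0 = coeff q n"
    using mobius_poly_homogenize[OF assms(2), of a] by metis
  have "poly h b \<noteq> 0" using h(2)[of b] h(3) assms(4,5) by (cases "b = 0") auto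
  moreover have "mobius a (Fract p q) = Fract g h"
    using assms(3) unfolding Fract_conv_to_fract[of g] g[symmetric] h(1)[symmetric]
    by (simp add: mobius_Fract)
  ultimately show ?thesis by (simp add: Fract_local_ring_Aff)
qed

text \<open>
  Each finite point \<open>b\<close> lies under a point other than \<open>a\<close>, namely \<open>a + 1/b\<close>, or infinity for
  \<open>b = 0\<close>.
\<close>

lemma mobius_local_ring:
  obtains s where "s \<noteq> Aff a" "\<And>f. f \<in> local_ring s \<Longrightarrow> mobius a f \<in> local_ring (Aff b)"
proof (cases "b = 0")
  case True
  have "mobius a f \<in> local_ring (Aff b)" if f: "f \<in> local_ring Infty" for f
  proof -
    obtain p q where "f = Fract p q" "q \<noteq> 0" "degree p \<le> degree q"
      using f by (auto simp: local_ring.simps)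
    then show ?thesis using True mobius_Fract_local_ring[of p "degree q" q b a] by simp
  qed
  then show ?thesis using that by blast
next
  case False
  have "mobius a f \<in> local_ring (Aff b)" if f: "f \<in> local_ring (Aff (a + inverse b))" for f
  proof -
    obtain p q where "f = Fract p q" "poly q (a + inverse b) \<noteq> 0"
      using f by (auto simp: local_ring.simps)
    moreover from this have "q \<noteq> 0" by auto
    ultimately show ?thesis
      using False mobius_Fract_local_ring[of p "max (degree p) (degree q)" q b a] by simp
  qed
  moreover have "Aff (a + inverse b) \<noteq> Aff a" using False by simp
  ultimately show ?thesis using that by blast
qed

text \<open>
  If the exceptional point is \<open>Aff a\<close>, the substitution \<open>T \<mapsto> a + 1/T\<close> moves it to infinity. It
  fixes the constants and is injective, so that constancy of the \<open>j\<close>-invariant can be tested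
  after the substitution.
\<close>

theorem j_constant_if_bad_at_one_point:
  fixes E :: "'k::alg_closed_field poly fract weierstrass"
  assumes char: "CHAR('k) = 2 \<or> CHAR('k) = 3" and E: "disc E \<noteq> 0"
    and good: "\<And>s. s \<noteq> s0 \<Longrightarrow> good_reduction E s"
  shows "j_invariant E \<in> constants"
proof (cases s0)
  case Infty
  then show ?thesis using j_constant_if_bad_only_at_Infty[OF char E] good by simp
next
  case (Aff a)
  let ?m = "map_weierstrass (mobius a)"
  have disc: "disc (?m E) \<noteq> 0" using E by (simp add: mobius_disc)
  have "good_reduction (?m E) (Aff b)" for b
  proof -
    obtain s where s: "s \<noteq> Aff a" "\<And>f. f \<in> local_ring s \<Longrightarrow> mobius a f \<in> local_ring (Aff b)"
      using mobius_local_ring by blast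
    obtain u r q t where u: "u \<noteq> 0" "unimodular_at s (change_vars u r q t E)"
      using good[of s] s(1) unfolding Aff good_reduction_iff[OF E] weierstrass_equation_of_def by blast
    then have "unimodular_at (Aff b) (?m (change_vars u r q t E))"
      using s(2) unfolding unimodular_at_def integral_at_def mobius_disc
      by (auto simp: weierstrass.set_map simp flip: mobius_inverse)
    moreover have "weierstrass_equation_of (?m E) (?m (change_vars u r q t E))"
      unfolding weierstrass_equation_of_def mobius_change_vars using u(1) by (metis mobius_eq_0_iff)
    ultimately show ?thesis unfolding good_reduction_iff[OF disc] by blast
  qed
  then have "j_invariant (?m E) \<in> constants"
    using j_constant_if_bad_only_at_Infty[OF char disc] by blast
  then obtain c where "mobius a (j_invariant E) = to_fract [:c:]"
    unfolding mobius_j_invariant constants_def by (auto simp: to_fract_def)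
  then have "mobius a (j_invariant E - to_fract [:c:]) = 0" by (simp add: mobius_diff)
  then have "j_invariant E = to_fract [:c:]" unfolding mobius_eq_0_iff by simp
  then show ?thesis by (auto simp: constants_def to_fract_def)
qed

theorem two_bad_points:
  fixes E :: "'k::alg_closed_field poly fract weierstrass"
  assumes char: "CHAR('k) = 2 \<or> CHAR('k) = 3"
    and E: "elliptic_curve E" "j_invariant E \<notin> constants"
  shows "\<exists>s s'. s \<noteq> s' \<and> bad_reduction E s \<and> bad_reduction E s'"
proof (rule ccontr)
  assume *: "\<nexists>s s'. s \<noteq> s' \<and> bad_reduction E s \<and> bad_reduction E s'"
  obtain s0 where "good_reduction E s" if "s \<noteq> s0" for s
    using * unfolding bad_reduction_def by metis
  then have "j_invariant E \<in> constants"
    using j_constant_if_bad_at_one_point[OF char] E(1) by (auto simp: elliptic_curve_def)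
  with E(2) show False by simp
qed

section \<open>Curves attaining the bounds\<close>

abbreviation T :: "'k::field poly fract" where
  "T \<equiv> to_fract [:0, 1:]"

lemma constantsE:
  assumes "f \<in> constants"
  obtains c where "f = to_fract [:c:]"
  using assms by (auto simp: constants_def to_fract_def)

lemma const_mem_constants [simp]: "to_fract [:c:] \<in> constants"
  by (auto simp: constants_def to_fract_def)

lemma constants_intros:
  fixes f g :: "'k::alg_closed_field poly fract"
  shows "f \<in> constants \<Longrightarrow> g \<in> constants \<Longrightarrow> f + g \<in> constants"
    and "f \<in> constants \<Longrightarrow> g \<in> constants \<Longrightarrow> f - g \<in> constants"
    and "f \<in> constants \<Longrightarrow> g \<in> constants \<Longrightarrow> f * g \<in> constants"
    and "f \<in> constants \<Longrightarrow> - f \<in> constants"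
    and "f \<in> constants \<Longrightarrow> f ^ n \<in> constants"
    and "numeral m \<in> (constants :: 'k poly fract set)"
  by (auto simp: mem_constants_iff intro!: local_ring_intros)

lemma constants_inverse:
  fixes f :: "'k::alg_closed_field poly fract"
  assumes "f \<in> constants"
  shows "inverse f \<in> constants"
proof (cases "f = 0")
  case False
  obtain c where c: "f = to_fract [:c:]" using constantsE[OF assms] .
  with False have "c \<noteq> 0" by auto
  then have "f * to_fract [:inverse c:] = to_fract [:1:]" by (simp add: c flip: to_fract_mult)
  then have "inverse f = to_fract [:inverse c:]" by (intro inverse_unique) (simp flip: one_pCons)
  then show ?thesis by simp
qed (use assms in simp)

lemma linear_not_constant: "to_fract [:c, d:] \<notin> constants" if "d \<noteq> 0"
proof
  assume "to_fract [:c, d:] \<in> constants"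
  then obtain b where "to_fract [:c, d:] = to_fract [:b:]" by (rule constantsE)
  then show False using that by simp
qed

text \<open>
  The right-hand side has a simple pole at infinity, whereas every pole of the left-hand side has
  order divisible by \<open>n\<close>. The proof compares degrees after clearing denominators.
\<close>

lemma no_artin_schreier_root:
  assumes "d \<noteq> 0" "n \<ge> 2"
  shows "f ^ n + to_fract [:b:] * f \<noteq> to_fract [:c, d:]"
proof
  assume eq: "f ^ n + to_fract [:b:] * f = to_fract [:c, d:]"
  obtain P Q where f: "f = Fract P Q" and Q: "Q \<noteq> 0" by (cases f) auto
  obtain m where n: "n = Suc m" and m: "m > 0" using assms(2) by (cases n) auto
  let ?p = to_fract
  have "?p (P ^ n + smult b (P * Q ^ m)) = ?p Q ^ n * (f ^ n + ?p [:b:] * f)"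
  proof -
    have "smult b (P * Q ^ m) = [:b:] * P * Q ^ m" by simp
    then have "?p (P ^ n + smult b (P * Q ^ m)) = ?p P ^ n + ?p [:b:] * ?p P * ?p Q ^ m"
      by (simp only: to_fract_add to_fract_mult to_fract_power)
    also have "\<dots> = ?p Q ^ n * (f ^ n + ?p [:b:] * f)"
      using Q by (simp add: f Fract_conv_to_fract n field_simps)
    finally show ?thesis .
  qed
  also have "\<dots> = ?p (Q ^ n * [:c, d:])"
    unfolding eq by (simp only: to_fract_mult to_fract_power)
  finally have *: "P ^ n + smult b (P * Q ^ m) = Q ^ n * [:c, d:]"
    unfolding to_fract_eq_iff .
  have degR: "degree (Q ^ n * [:c, d:]) = n * degree Q + 1"
    using Q assms(1) by (simp add: degree_mult_eq degree_power_eq del: mult_pCons_right)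
  have deg2: "degree (smult b (P * Q ^ m)) \<le> degree P + m * degree Q"
    using Q by (cases "P = 0") (auto simp: degree_mult_eq degree_power_eq intro: order.trans[OF degree_smult_le])
  have degP: "degree (P ^ n) = n * degree P"
    by (cases "P = 0") (auto simp: degree_power_eq n zero_power degree_mult_eq)
  show False
  proof (cases "degree P \<le> degree Q")
    case True
    have "degree (P ^ n + smult b (P * Q ^ m)) \<le> n * degree Q"
    proof (rule degree_add_le)
      show "degree (P ^ n) \<le> n * degree Q" unfolding degP using True by simp
      show "degree (smult b (P * Q ^ m)) \<le> n * degree Q"
        using deg2 True unfolding n mult_Suc by linarith
    qed
    then show False using degR unfolding * by simp
  next
    case False
    then have "m * degree Q < m * degree P" using m by simp
    then have "degree (smult b (P * Q ^ m)) < degree (P ^ n)"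
      using deg2 unfolding degP unfolding n mult_Suc by linarith
    then have "degree (P ^ n + smult b (P * Q ^ m)) = n * degree P"
      using degP by (simp add: degree_add_eq_left)
    then have "n * degree P = n * degree Q + 1" using degR unfolding * by simp
    then have "n dvd 1" by (metis dvd_add_right_iff dvd_triv_left)
    then show False using assms(2) by simp
  qed
qed

lemma artin_schreier_not_constant:
  fixes f :: "'k::alg_closed_field poly fract"
  assumes "n \<ge> 2" "b \<in> constants" "d \<noteq> 0"
  shows "f ^ n + b * f - to_fract [:c, d:] \<notin> constants"
proof
  assume "f ^ n + b * f - to_fract [:c, d:] \<in> constants"
  then obtain e where e: "f ^ n + b * f - to_fract [:c, d:] = to_fract [:e:]" by (rule constantsE)
  obtain b' where b: "b = to_fract [:b':]" using constantsE[OF assms(2)] .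
  have "f ^ n + b * f = to_fract [:c, d:] + to_fract [:e:]" using e by (simp add: algebra_simps)
  then have "f ^ n + to_fract [:b':] * f = to_fract [:c + e, d:]"
    unfolding b by (simp flip: to_fract_add)
  then show False using no_artin_schreier_root assms(1,3) by blast
qed

lemma good_reduction_if_unimodular: "unimodular_at s E \<Longrightarrow> good_reduction E s"
  using good_reduction_iff weierstrass_equation_of_refl unfolding unimodular_at_def by blast

lemma bad_at_exactly_one_point:
  fixes E :: "'k::alg_closed_field poly fract weierstrass"
  assumes "\<not> constant_curve E" "\<And>a. unimodular_at (Aff a) E"
  shows "elliptic_curve E \<and> \<not> constant_curve E \<and> card {s. bad_reduction E s} = 1"
proof -
  have E: "elliptic_curve E" using assms(2) by (auto simp: elliptic_curve_def unimodular_at_def)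
  have "\<not> bad_reduction E (Aff a)" for a
    using good_reduction_if_unimodular assms(2) by (auto simp: bad_reduction_def)
  then have "s = Infty" if "bad_reduction E s" for s using that by (cases s) auto
  moreover have "\<exists>s. bad_reduction E s"
    using constant_if_good_reduction_everywhere[OF E] assms(1) by (auto simp: bad_reduction_def)
  ultimately have "{s. bad_reduction E s} = {Infty}" by blast
  then show ?thesis using E assms(1) by simp
qed

text \<open>
  The curve is the quadratic twist of \<open>y\<^sup>2 + x y = x\<^sup>3 + 1\<close> by the Artin-Schreier extension
  \<open>s\<^sup>2 + s = T\<close>, which is ramified only at infinity. A constant equation would force this extension
  to be trivial: comparing \<open>a1\<close> and \<open>a3\<close> shows that \<open>u\<close> and \<open>r\<close> are constant, and then the
  coefficient \<open>a2\<close> puts \<open>s\<^sup>2 + s - T\<close> into \<open>k\<close>.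
\<close>

lemma example_char_2:
  assumes "CHAR('k::alg_closed_field) = 2"
  defines "E \<equiv> Weierstrass 1 T 0 0 1 :: 'k poly fract weierstrass"
  shows "elliptic_curve E \<and> \<not> constant_curve E \<and> card {s. bad_reduction E s} = 1"
proof (rule bad_at_exactly_one_point)
  have z: "(2 :: 'k poly fract) = 0" using fract_char_zero[where ?'k = 'k] assms(1) by simp
  have "(4 :: 'k poly fract) = 2 * 2" "(27 :: 'k poly fract) = 2 * 13 + 1" by simp_all
  then have num: "(4 :: 'k poly fract) = 0" "(27 :: 'k poly fract) = 1"
    by (simp_all only: z mult_zero_left add_0)
  have "disc E = - 1"
    by (simp add: E_def disc_def b2_def b4_def b6_def b8_def num)
  then show "unimodular_at (Aff a) E" for a
    by (simp add: unimodular_at_def integral_at_iff local_ring_uminus) (simp add: E_def)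
  show "\<not> constant_curve E"
  proof
    assume "constant_curve E"
    then obtain u r s t where u: "u \<noteq> 0" and
      const: "set_weierstrass (change_vars u r s t E) \<subseteq> constants"
      unfolding constant_curve_def weierstrass_equation_of_def by blast
    define W where "W = change_vars u r s t E"
    note W = scaled_coefficients[OF u, of r s t E, folded W_def]
    have c: "a1 W \<in> constants" "a2 W \<in> constants" "a3 W \<in> constants"
      using const by (cases W; auto simp: W_def[symmetric])+
    have "a1 W * u = 1" using W(1) by (simp add: E_def z mult.commute)
    then have "u = inverse (a1 W)" by (metis inverse_unique)
    then have uc: "u \<in> constants" using constants_inverse c(1) by simp
    have "u ^ 3 * a3 W = r" using W(3) by (simp add: E_def z)
    then have "r \<in> constants" using constants_intros(3,5) uc c(3) by metis
    then have "3 * r - u^2 * a2 W \<in> constants" using uc c(2) by (intro constants_intros)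
    moreover have "3 * r - u^2 * a2 W = s ^ 2 + 1 * s - T"
      using W(2) by (simp add: E_def)
    moreover have "1 \<in> (constants :: 'k poly fract set)" by (simp add: mem_constants_iff)
    ultimately show False
      using artin_schreier_not_constant[of 2 1 1 s 0] by simp
  qed
qed

text \<open>
  The curve is a twist of the supersingular curve \<open>y\<^sup>2 = x\<^sup>3 - x\<close> by the Artin-Schreier extension
  \<open>r\<^sup>3 - r = - T\<close>, acting through the translations of \<open>x\<close> by the prime field. The discriminant
  forces \<open>u\<close> to be constant, the coefficient \<open>a3\<close> then does so for \<open>t\<close>, and \<open>a6\<close> puts
  \<open>r\<^sup>3 - r + T\<close> into \<open>k\<close>.
\<close>

lemma example_char_3:
  assumes "CHAR('k::alg_closed_field) = 3"
  defines "E \<equiv> Weierstrass 0 0 0 (- 1) T :: 'k poly fract weierstrass"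
  shows "elliptic_curve E \<and> \<not> constant_curve E \<and> card {s. bad_reduction E s} = 1"
proof (rule bad_at_exactly_one_point)
  have z: "(3 :: 'k poly fract) = 0" using fract_char_zero[where ?'k = 'k] assms(1) by simp
  have "(8 :: 'k poly fract) = 3 * 3 - 1" "(27 :: 'k poly fract) = 3 * 9" "(2 :: 'k poly fract) = 3 - 1"
    by simp_all
  then have num: "(8 :: 'k poly fract) = - 1" "(27 :: 'k poly fract) = 0" "(2 :: 'k poly fract) = - 1"
    by (simp_all only: z mult_zero_left diff_0)
  have disc: "disc E = 1"
    by (simp add: E_def disc_def b2_def b4_def num)
  then show "unimodular_at (Aff a) E" for a
    by (simp add: unimodular_at_def integral_at_iff) (simp add: E_def local_ring_uminus)
  show "\<not> constant_curve E"
  proof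
    assume "constant_curve E"
    then obtain u r s t where u: "u \<noteq> 0" and
      const: "set_weierstrass (change_vars u r s t E) \<subseteq> constants"
      unfolding constant_curve_def weierstrass_equation_of_def by blast
    define W where "W = change_vars u r s t E"
    note W = scaled_coefficients[OF u, of r s t E, folded W_def]
    have c: "a1 W \<in> constants" "a2 W \<in> constants" "a3 W \<in> constants" "a4 W \<in> constants" "a6 W \<in> constants"
      using const by (cases W; auto simp: W_def[symmetric])+
    have "disc W \<in> constants"
      unfolding disc_def b2_def b4_def b6_def b8_def by (intro constants_intros c)
    moreover have "disc W * u ^ 12 = 1" 
      using disc_change_vars[OF u, of r s t E] by (simp add: W_def disc mult.commute)
    ultimately have "u ^ 12 \<in> constants" using constants_inverse inverse_unique by metis
    then have uc: "u \<in> constants" using u by (intro constant_root[of u 12]) auto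
    have "t = - (u ^ 3 * a3 W)" using W(3) by (simp add: E_def num)
    moreover have "- (u ^ 3 * a3 W) \<in> constants" using uc c by (intro constants_intros)
    ultimately have "t \<in> constants" by simp
    then have "u ^ 6 * a6 W + t ^ 2 \<in> constants" using uc c by (intro constants_intros)
    moreover have "u ^ 6 * a6 W + t ^ 2 = r ^ 3 + (- 1) * r - to_fract [:0, - 1:]"
    proof -
      have "to_fract [:0, - 1 :: 'k:] = - T" by (simp flip: to_fract_uminus)
      then show ?thesis using W(5) by (simp add: E_def)
    qed
    moreover have "- 1 \<in> (constants :: 'k poly fract set)" by (simp add: mem_constants_iff local_ring_uminus)
    ultimately show False
      using artin_schreier_not_constant[of 3 "- 1" "- 1" r 0] by simp
  qed
qed

text \<open>
  In both characteristics the discriminant is \<open>- T\<close> and \<open>j = - 1/T\<close>. Bad reduction at \<open>0\<close> and at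
  infinity is forced by the general bound: there are at least two bad points, and all others are
  good.
\<close>

lemma example_two_bad_points:
  assumes char: "CHAR('k::alg_closed_field) = 2 \<or> CHAR('k) = 3"
  defines "E \<equiv> Weierstrass 1 0 0 0 T :: 'k poly fract weierstrass"
  shows "elliptic_curve E \<and> j_invariant E \<notin> constants \<and> card {s. bad_reduction E s} = 2"
proof -
  \<comment> \<open>\<open>432 = 2\<^sup>4 * 3\<^sup>3\<close>\<close>
  have "(432 :: 'k poly fract) = 0"
  proof -
    have "(2 :: 'k poly fract) = 0 \<or> (3 :: 'k poly fract) = 0"
      using char fract_char_zero[where ?'k = 'k] by auto
    moreover have "(432 :: 'k poly fract) = 2 * 216" "(432 :: 'k poly fract) = 3 * 144" by simp_all
    ultimately show ?thesis by (metis mult_zero_left)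
  qed
  moreover have "disc E = - T - 432 * T ^ 2"
    by (simp add: E_def disc_def b2_def b4_def b6_def b8_def power2_eq_square)
  ultimately have disc: "disc E = - T" by simp
  then have E: "elliptic_curve E" by (simp add: elliptic_curve_def)
  have j: "j_invariant E \<notin> constants"
  proof
    assume "j_invariant E \<in> constants"
    then have "inverse (j_invariant E) \<in> constants" by (rule constants_inverse)
    also have "inverse (j_invariant E) = - T"
      by (simp add: j_invariant_def disc) (simp add: E_def c4_def b2_def b4_def)
    finally have "- (- T) \<in> (constants :: 'k poly fract set)" by (rule constants_intros(4))
    then show False using linear_not_constant[of "1 :: 'k" 0] by simp
  qed
  have "\<not> bad_reduction E (Aff a)" if "a \<noteq> 0" for a
  proof -
    have "inverse (T :: 'k poly fract) \<in> local_ring (Aff a)" using that by (intro inverse_poly_local_ring) simp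
    then have "unimodular_at (Aff a) E"
      by (simp add: unimodular_at_def integral_at_iff disc local_ring_uminus) (simp add: E_def)
    then show ?thesis using good_reduction_if_unimodular by (auto simp: bad_reduction_def)
  qed
  then have "s \<in> {Aff 0, Infty}" if "bad_reduction E s" for s using that by (cases s) auto
  then have sub: "{s. bad_reduction E s} \<subseteq> {Aff 0, Infty}" by blast
  obtain s s' where "s \<noteq> s'" "bad_reduction E s" "bad_reduction E s'"
    using two_bad_points[OF char E j] by blast
  with sub have "{s. bad_reduction E s} = {Aff 0, Infty}" by auto
  then show ?thesis using E j by simp
qed

theorem theorem2:
  assumes "CHAR('k::alg_closed_field) = 2 \<or> CHAR('k) = 3"
  shows
    "(\<forall>E :: 'k poly fract weierstrass. elliptic_curve E \<and> j_invariant E \<notin> constants \<longrightarrow>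
        (\<exists>s s'. s \<noteq> s' \<and> bad_reduction E s \<and> bad_reduction E s')) \<and>
     (\<forall>E :: 'k poly fract weierstrass. elliptic_curve E \<and> \<not> constant_curve E \<longrightarrow>
        (\<exists>s. bad_reduction E s)) \<and>
     (\<exists>E :: 'k poly fract weierstrass. elliptic_curve E \<and> j_invariant E \<notin> constants \<and>
        card {s. bad_reduction E s} = 2) \<and>
     (\<exists>E :: 'k poly fract weierstrass. elliptic_curve E \<and> \<not> constant_curve E \<and>
        card {s. bad_reduction E s} = 1)"
proof (intro conjI)
  show "\<forall>E :: 'k poly fract weierstrass. elliptic_curve E \<and> j_invariant E \<notin> constants \<longrightarrow>
        (\<exists>s s'. s \<noteq> s' \<and> bad_reduction E s \<and> bad_reduction E s')"
    using two_bad_points[OF assms] by blast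
  show "\<forall>E :: 'k poly fract weierstrass. elliptic_curve E \<and> \<not> constant_curve E \<longrightarrow>
        (\<exists>s. bad_reduction E s)"
    using constant_if_good_reduction_everywhere unfolding bad_reduction_def by blast
  show "\<exists>E :: 'k poly fract weierstrass. elliptic_curve E \<and> j_invariant E \<notin> constants \<and>
        card {s. bad_reduction E s} = 2"
    using example_two_bad_points[OF assms] by blast
  show "\<exists>E :: 'k poly fract weierstrass. elliptic_curve E \<and> \<not> constant_curve E \<and>
        card {s. bad_reduction E s} = 1"
    using assms example_char_2[where 'k = 'k] example_char_3[where 'k = 'k] by blast
qed

end
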